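(* Let $q_1(\cdot)\in \mathscr{C}^{\log}(\mathbb{R}^n)\cap\mathscr{P}(\mathbb{R}^n)$ satisfy $$1<q_1(\infty)\le q_1(x)\le (q_1)_+<\infty\qquad (x\in\mathbb{R}^n).$$ Let $\beta:\mathbb{R}^n\to[0,n)$ be a measurable function (not assumed continuous) such that $$\operatorname*{ess\,inf}_{x\in\mathbb{R}^n}\beta(x)>0,\qquad \operatorname*{ess\,sup}_{x\in\mathbb{R}^n}q_1(x)\beta(x)<n,\qquad \operatorname*{ess\,sup}_{x\in\mathbb{R}^n}q_1(\infty)\beta(x)<n.$$ Define the variable exponent $q_2(\cdot)$ by $$\frac1{q_2(x)}=\frac1{q_1(x)}-\frac{\beta(x)}{n}.$$ Let $C_\infty>0$ be a constant such that $|q_1(x)-q_1(\infty)|\le \frac{C_\infty}{\ln(e+|x|)}$ for all $x\in\mathbb{R}^n$, and set $$\gamma(x)=C_\infty\,\beta(x)\Big(1-\frac{\beta(x)}{n}\Big).$$ Let $\delta_1\in(0,1/(q_1')_+)$ be a constant for which there is $C_0>0$ with $$\frac{\|\chi_S\|_{L^{q_1'(\cdot)}(\mathbb{R}^n)}}{\|\chi_B\|_{L^{q_1'(\cdot)}(\mathbb{R}^n)}}\le C_0\Big(\frac{|S|}{|B|}\Big)^{\delta_1}$$ for all balls $B\subset\mathbb{R}^n$ and all measurable subsets $S\subset B$. Let $0<p_1\le p_2<\infty$, $\lambda\ge 0$ and $\alpha\in\mathbb{R}$ with $\alpha<\lambda+n\delta_1$. Then there is a constant $C>0$, independent of $f$,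 such that for every $f\in M\dot K^{\alpha,\lambda}_{p_1,q_1(\cdot)}(\mathbb{R}^n)$, $$\Big\|(1+|x|)^{-\gamma(x)}\mathscr{H}_{\beta(\cdot)}(f)\Big\|_{M\dot K^{\alpha,\lambda}_{p_2,q_2(\cdot)}(\mathbb{R}^n)}\le C\,\|f\|_{M\dot K^{\alpha,\lambda}_{p_1,q_1(\cdot)}(\mathbb{R}^n)}.$$
   Context: Operator: for a locally integrable function $f$ on $\mathbb{R}^n$ and measurable $\beta$ with $0\le\beta(x)<n$, the $n$-dimensional fractional Hardy-type operator of variable order $\beta(x)$ is $$\mathscr{H}_{\beta(\cdot)}(f)(x)=\frac1{|x|^{n-\beta(x)}}\int_{|t|<|x|}f(t)\,dt,\qquad x\in\mathbb{R}^n\setminus\{0\}.$$ Exponents: for a measurable function $q(\cdot)$ on $\mathbb{R}^n$, $q_-=\operatorname{ess\,inf}_{x\in\mathbb{R}^n} q(x)$, $q_+=\operatorname{ess\,sup}_{x\in\mathbb{R}^n} q(x)$, and $q'(x)=\frac{q(x)}{q(x)-1}$ is the conjugate exponent. $\mathscr{P}(\mathbb{R}^n)$ is the set of measurable $q(\cdot):\mathbb{R}^n\to(1,\infty)$ with $1<q_-\le q(x)\le q_+<\infty$ for $x\in\mathbb{R}^n$. $\mathscr{C}^{\log}(\mathbb{R}^n)$ is the set of functions $q(\cdot):\mathbb{R}^n\to(0,\infty)$ for which there are constants $C,C_\infty>0$ such that $$|q(x)-q(y)|\le\frac{-C}{\ln(|x-y|)}\ \text{ for } |x-y|\le 1/2,\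 x,y\in\mathbb{R}^n,\qquad |q(x)-q(\infty)|\le\frac{C_\infty}{\ln(e+|x|)}\ \text{ for } x\in\mathbb{R}^n,$$ where $q(\infty)=\lim_{|x|\to\infty}q(x)$. Variable Lebesgue spaces: for measurable $\Omega\subset\mathbb{R}^n$ with $|\Omega|>0$ and measurable $q(\cdot):\Omega\to[1,\infty)$, $L^{q(\cdot)}(\Omega)$ is the space of measurable $f$ with $\int_\Omega (|f(x)|/\eta)^{q(x)}dx<\infty$ for some $\eta>0$, with norm $\|f\|_{L^{q(\cdot)}(\Omega)}=\inf\{\eta>0:\int_\Omega(|f(x)|/\eta)^{q(x)}dx\le1\}$. $L^{q(\cdot)}_{\mathrm{loc}}(\Omega)$ is the set of measurable $f$ with $f\in L^{q(\cdot)}(\Omega_0)$ for all compact subsets $\Omega_0\subset\Omega$. Herz-Morrey spaces: let $B_k=\{x\in\mathbb{R}^n:|x|\le 2^k\}$, $A_k=B_k\setminus B_{k-1}$, $\chi_k=\chi_{A_k}$ for $k\in\mathbb{Z}$. For $\alpha\in\mathbb{R}$, $0\le\lambda<\infty$, $0<p<\infty$, $q(\cdot)\in\mathscr{P}(\mathbb{R}^n)$, the space $M\dot K^{\alpha,\lambda}_{p,q(\cdot)}(\mathbb{R}^n)$ consists of all $f\in L^{q(\cdot)}_{\mathrm{loc}}(\mathbb{R}^n\setminus\{0\})$ with $$\|f\|_{M\dot K^{\alpha,\lambda}_{p,q(\cdot)}(\mathbb{R}^n)}=\sup_{k_0\in\mathbb{Z}}2^{-k_0\lambda}\Big(\sum_{k=-\infty}^{k_0}2^{k\alpha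 p}\|f\chi_k\|^p_{L^{q(\cdot)}(\mathbb{R}^n)}\Big)^{1/p}<\infty.$$ Here $|S|$ denotes Lebesgue measure and $\chi_S$ the characteristic function of a measurable set $S\subset\mathbb{R}^n$. *)

theory Defs
  imports "HOL-Analysis.Analysis" "HOL-Probability.Essential_Supremum"
begin

text \<open>
  Measurability, integrals and null sets on \<open>\<real>\<^sup>n\<close> (rendered as \<open>real ^ 'n\<close>) refer to the complete
  Lebesgue measure \<open>lebesgue\<close>. Norms take values in \<open>ennreal\<close>, with value \<open>\<infinity>\<close> outside the space.
\<close>

definition ess_sup :: "(real ^ 'n \<Rightarrow> real) \<Rightarrow> ereal" where
  "ess_sup q = esssup lebesgue (\<lambda>x. ereal (q x))"

definition ess_inf :: "(real ^ 'n \<Rightarrow> real) \<Rightarrow> ereal" where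
  "ess_inf q = - esssup lebesgue (\<lambda>x. - ereal (q x))"

definition conj_exponent :: "(real ^ 'n \<Rightarrow> real) \<Rightarrow> real ^ 'n \<Rightarrow> real" where
  "conj_exponent q x = q x / (q x - 1)"

definition exponent_class :: "(real ^ 'n \<Rightarrow> real) set" where
  "exponent_class = {q. q \<in> borel_measurable lebesgue \<and> (\<forall>x. 1 < q x) \<and>
     1 < ess_inf q \<and> (\<forall>x. ess_inf q \<le> ereal (q x) \<and> ereal (q x) \<le> ess_sup q) \<and> ess_sup q < \<infinity>}"

text \<open>The value \<open>q(\<infinity>)\<close>; meaningful only if the limit exists, which \<open>log_hoelder_class\<close> requires.\<close>

definition at_infty :: "(real ^ 'n \<Rightarrow> real) \<Rightarrow> real" where
  "at_infty q = Lim at_infinity q"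

text \<open>For \<open>x = y\<close> the first estimate is vacuous: both sides are \<open>0\<close>, since \<open>ln 0 = 0\<close> and \<open>a / 0 = 0\<close>.\<close>

definition log_hoelder_class :: "(real ^ 'n \<Rightarrow> real) set" where
  "log_hoelder_class = {q. (\<forall>x. 0 < q x) \<and>
     (\<exists>C>0. \<forall>x y. norm (x - y) \<le> 1 / 2 \<longrightarrow> \<bar>q x - q y\<bar> \<le> - C / ln (norm (x - y))) \<and>
     (\<exists>l. (q \<longlongrightarrow> l) at_infinity) \<and>
     (\<exists>C>0. \<forall>x. \<bar>q x - at_infty q\<bar> \<le> C / ln (exp 1 + norm x))}"

definition var_modular ::
  "(real ^ 'n) set \<Rightarrow> (real ^ 'n \<Rightarrow> real) \<Rightarrow> real \<Rightarrow> (real ^ 'n \<Rightarrow> 'b::real_normed_vector) \<Rightarrow> ennreal" where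
  "var_modular \<Omega> q \<eta> f = (\<integral>\<^sup>+x\<in>\<Omega>. ennreal ((norm (f x) / \<eta>) powr q x) \<partial>lebesgue)"

definition var_Lebesgue ::
  "(real ^ 'n) set \<Rightarrow> (real ^ 'n \<Rightarrow> real) \<Rightarrow> (real ^ 'n \<Rightarrow> 'b::real_normed_vector) set" where
  "var_Lebesgue \<Omega> q =
     {f. f \<in> borel_measurable (lebesgue_on \<Omega>) \<and> (\<exists>\<eta>>0. var_modular \<Omega> q \<eta> f < \<infinity>)}"

definition var_norm ::
  "(real ^ 'n) set \<Rightarrow> (real ^ 'n \<Rightarrow> real) \<Rightarrow> (real ^ 'n \<Rightarrow> 'b::real_normed_vector) \<Rightarrow> ennreal" where
  "var_norm \<Omega> q f = (INF \<eta>\<in>{\<eta>. 0 < \<eta> \<and> var_modular \<Omega> q \<eta> f \<le> 1}. ennreal \<eta>)"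

definition var_Lebesgue_loc ::
  "(real ^ 'n) set \<Rightarrow> (real ^ 'n \<Rightarrow> real) \<Rightarrow> (real ^ 'n \<Rightarrow> 'b::real_normed_vector) set" where
  "var_Lebesgue_loc \<Omega> q =
     {f. f \<in> borel_measurable (lebesgue_on \<Omega>) \<and>
         (\<forall>\<Omega>\<^sub>0. compact \<Omega>\<^sub>0 \<and> \<Omega>\<^sub>0 \<subseteq> \<Omega> \<longrightarrow> f \<in> var_Lebesgue \<Omega>\<^sub>0 q)}"

definition frac_Hardy ::
  "(real ^ 'n \<Rightarrow> real) \<Rightarrow> (real ^ 'n \<Rightarrow> 'b::{banach, second_countable_topology}) \<Rightarrow> real ^ 'n \<Rightarrow> 'b" where
  "frac_Hardy \<beta> f x =
     (1 / norm x powr (real CARD('n) - \<beta> x)) *\<^sub>R (LINT t:{t. norm t < norm x}|lebesgue. f t)"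

definition dyadic_ball :: "int \<Rightarrow> (real ^ 'n) set" where
  "dyadic_ball k = {x. norm x \<le> 2 powi k}"

definition dyadic_annulus :: "int \<Rightarrow> (real ^ 'n) set" where
  "dyadic_annulus k = dyadic_ball k - dyadic_ball (k - 1)"

text \<open>Real powers of extended nonnegative reals, used only for positive exponents.\<close>

definition epowr :: "ennreal \<Rightarrow> real \<Rightarrow> ennreal" where
  "epowr x p = (if x = \<infinity> then \<infinity> else ennreal (enn2real x powr p))"

definition herz_morrey_norm ::
  "real \<Rightarrow> real \<Rightarrow> real \<Rightarrow> (real ^ 'n \<Rightarrow> real) \<Rightarrow> (real ^ 'n \<Rightarrow> 'b::real_normed_vector) \<Rightarrow> ennreal" where
  "herz_morrey_norm \<alpha> lam p q f =
     (SUP k\<^sub>0::int. ennreal (2 powr (- of_int k\<^sub>0 * lam)) *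
        epowr (\<Sum>\<^sub>\<infinity>k\<in>{..k\<^sub>0}. ennreal (2 powr (of_int k * \<alpha> * p)) *
                 epowr (var_norm UNIV q (\<lambda>x. indicator (dyadic_annulus k) x *\<^sub>R f x)) p) (1 / p))"

definition herz_morrey ::
  "real \<Rightarrow> real \<Rightarrow> real \<Rightarrow> (real ^ 'n \<Rightarrow> real) \<Rightarrow> (real ^ 'n \<Rightarrow> 'b::real_normed_vector) set" where
  "herz_morrey \<alpha> lam p q = {f \<in> var_Lebesgue_loc (- {0}) q. herz_morrey_norm \<alpha> lam p q f < \<infinity>}"

end

theory Submission
  imports Defs
begin

text \<open>
  The proof compares everything with one dyadic annulus at a time. On the annulus of radius about
  \<open>2\<^sup>k\<close> the log-Hoelder conditions say that \<open>q\<^sub>1\<close> differs from a constant \<open>s k\<close> by at most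
  \<open>D / \<bar>k\<bar>\<close>, where \<open>s k = q\<^sub>1 0\<close> for \<open>k \<le> 0\<close> and \<open>s k = q\<^sub>1(\<infinity>)\<close> for \<open>k > 0\<close>
  (\<open>log_hoelder_annulus_bound\<close>). Hence powers of \<open>2\<^sup>k\<close> with exponent \<open>q\<^sub>1\<close> may be replaced, up to a
  bounded factor, by powers with exponent \<open>s k\<close>, and two estimates follow as if the exponents were
  constant. The first is Hoelder's inequality against the characteristic function,
  \<open>\<integral>\<bar>f\<bar> \<le> K 2\<^bsup>kn(1 - 1/s k)\<^esup> \<parallel>f\<parallel>\<close> over the \<open>k\<close>-th annulus (\<open>nn_integral_annulus_le\<close>). The second
  bounds the \<open>q\<^sub>2\<close>-norm of \<open>\<bar>x\<bar>\<^bsup>\<beta>(x) - n\<^esup>\<close> on that annulus by \<open>K 2\<^bsup>- kn(1 - 1/s k)\<^esup>\<close>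
  (\<open>var_norm_annulus_le\<close>); here \<open>\<beta>\<close> may be rough, because it enters only through the pointwise
  relation \<open>\<beta> = n/q\<^sub>1 - n/q\<^sub>2\<close>.

  The ball \<open>\<bar>t\<bar> < \<bar>x\<bar>\<close> is covered by the annuli of index at most \<open>k\<close>, so the two estimates multiply to
  a convolution: the norm of the image on the \<open>k\<close>-th annulus is at most a constant times
  \<open>\<Sum>i. 2\<^bsup>- i n \<delta>\<^sub>1\<^esup> \<parallel>f \<chi>\<^bsub>k - i\<^esub>\<parallel>\<close>. The decay rate \<open>n \<delta>\<^sub>1\<close> is admissible because
  \<open>\<delta>\<^sub>1 \<le> 1 - 1/q\<^sub>1(\<infinity>) \<le> 1 - 1/q\<^sub>1 0\<close>, the first inequality being what \<open>\<delta>\<^sub>1 < 1/(q\<^sub>1')\<^sub>+\<close> gives at infinity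
  (\<open>le_of_less_inverse_ess_sup_conj_exponent\<close>). The weight \<open>(1 + \<bar>x\<bar>)\<^bsup>- \<gamma>(x)\<^esup>\<close> is at most \<open>1\<close>.

  It remains to bound this convolution on the sequence space underlying the Herz-Morrey norm
  (\<open>herz_morrey_seq_convolution_le\<close>). A shift by \<open>i\<close> costs \<open>2\<^bsup>i(\<alpha> - lam)\<^esup>\<close>, which the kernel
  compensates exactly when \<open>\<alpha> < lam + n \<delta>\<^sub>1\<close>.
\<close>

section \<open>Real powers and series of extended nonnegative reals\<close>

lemma epowr_ennreal: "0 \<le> r \<Longrightarrow> epowr (ennreal r) p = ennreal (r powr p)"
  by (simp add: epowr_def)

lemma epowr_mono:
  assumes "x \<le> y" "0 < p"
  shows "epowr x p \<le> epowr y p"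
proof (cases "y = \<infinity>")
  case False
  then obtain b where b: "y = ennreal b" "0 \<le> b" by (cases y) auto
  with assms obtain a where a: "x = ennreal a" "0 \<le> a" by (cases x) (auto simp: top_unique)
  show ?thesis using a b assms by (auto simp: epowr_ennreal intro!: ennreal_leI powr_mono2)
qed (simp add: epowr_def)

lemma epowr_mult:
  assumes "0 < p"
  shows "epowr (x * y) p = epowr x p * epowr y p"
proof -
  have "epowr (\<infinity> * z) p = \<infinity> * epowr z p" for z
    using assms by (cases z) (auto simp: epowr_def ennreal_top_mult ennreal_mult_top ennreal_eq_0_iff)
  moreover have "epowr (ennreal a * ennreal b) p = epowr (ennreal a) p * epowr (ennreal b) p"
    if "0 \<le> a" "0 \<le> b" for a b
    using that by (simp add: epowr_ennreal powr_mult flip: ennreal_mult)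
  moreover have "epowr \<infinity> p = \<infinity>"
    by (simp add: epowr_def)
  ultimately show ?thesis
    by (cases x; cases y) (auto, metis mult.commute)
qed

lemma epowr_epowr: "epowr (epowr x p) q = epowr x (p * q)"
  by (cases x) (auto simp: epowr_def powr_powr)

lemma epowr_one [simp]: "epowr x 1 = x"
  by (cases x) (auto simp: epowr_def)

lemma epowr_add: "0 < a \<Longrightarrow> 0 < b \<Longrightarrow> epowr x (a + b) = epowr x a * epowr x b"
  by (cases x) (auto simp: epowr_def powr_add ennreal_mult)

lemma epowr_eq_top_iff: "epowr x p = \<infinity> \<longleftrightarrow> x = \<infinity>"
  by (simp add: epowr_def)

lemma term_le_suminf_ennreal:
  fixes f :: "nat \<Rightarrow> ennreal"
  shows "f i \<le> (\<Sum>i. f i)"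
  using sum_le_suminf[of f "{i}"] by simp

lemma suminf_swap_ennreal:
  fixes f :: "nat \<Rightarrow> nat \<Rightarrow> ennreal"
  shows "(\<Sum>i. \<Sum>j. f i j) = (\<Sum>j. \<Sum>i. f i j)"
proof -
  have "(\<Sum>j. \<Sum>i. f i j) = (\<Sum>j. (\<integral>\<^sup>+i. f i j \<partial>count_space UNIV))"
    by (simp add: nn_integral_count_space_nat)
  also have "\<dots> = (\<integral>\<^sup>+i. (\<Sum>j. f i j) \<partial>count_space UNIV)"
    by (rule nn_integral_suminf[symmetric]) simp
  finally show ?thesis by (simp add: nn_integral_count_space_nat)
qed

lemma infsum_int_atMost_ennreal:
  fixes f :: "int \<Rightarrow> ennreal"
  shows "(\<Sum>\<^sub>\<infinity>k\<in>{..m}. f k) = (\<Sum>i. f (m - int i))"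
proof -
  have "bij_betw (\<lambda>i. m - int i) UNIV {..m}"
    by (rule bij_betwI[where g = "\<lambda>k. nat (m - k)"]) auto
  then have "(\<Sum>\<^sub>\<infinity>k\<in>{..m}. f k) = (\<Sum>\<^sub>\<infinity>i\<in>UNIV. f (m - int i))"
    by (rule infsum_reindex_bij_betw[symmetric])
  also have "\<dots> = (\<Sum>i. f (m - int i))"
    by (intro sums_unique has_sum_imp_sums has_sum_infsum nonneg_summable_on_complete) simp
  finally show ?thesis .
qed

abbreviation pow2 :: "real \<Rightarrow> ennreal" where
  "pow2 t \<equiv> ennreal (2 powr t)"

lemma pow2_mult: "pow2 s * pow2 t = pow2 (s + t)"
  by (simp add: powr_add ennreal_mult)

lemma epowr_pow2: "epowr (pow2 t) p = pow2 (t * p)"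
  by (simp add: epowr_ennreal powr_powr)

lemma suminf_geometric_pow2:
  assumes "0 < e"
  obtains C where "0 < C" "(\<Sum>i. pow2 (- (real i * e))) = ennreal C"
proof -
  define r where "r = 2 powr (- e)"
  have r: "0 < r" "r < 1" using assms by (auto simp: r_def powr_less_one)
  have "(\<Sum>i. pow2 (- (real i * e))) = (\<Sum>i. ennreal (r ^ i))"
    by (simp add: r_def powr_realpow[symmetric] powr_powr mult.commute)
  also have "\<dots> = ennreal (\<Sum>i. r ^ i)"
    using r by (intro suminf_ennreal2) (auto intro!: summable_geometric)
  also have "(\<Sum>i. r ^ i) = 1 / (1 - r)"
    using r by (intro suminf_geometric) auto
  finally show ?thesis using that[of "1 / (1 - r)"] r by simp
qed

section \<open>The discrete inequality\<close>

text \<open>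
  The inclusion of \<open>\<ell>\<^sup>p\<close> in \<open>\<ell>\<^sup>q\<close>: each \<open>a i\<close> is at most the \<open>\<ell>\<^sup>p\<close> norm, so the surplus power \<open>q - p\<close> of
  \<open>a i\<close> can be replaced by the norm.
\<close>

lemma suminf_epowr_le:
  assumes "0 < p" "p \<le> q"
  shows "(\<Sum>i. epowr (a i) q) \<le> epowr (\<Sum>i. epowr (a i) p) (q / p)"
proof (cases "p = q")
  case True
  then show ?thesis using assms by simp
next
  case False
  define S where "S = (\<Sum>i. epowr (a i) p)"
  have pos: "0 < (q - p) / p" "0 < p" using assms False by auto
  have "epowr (a i) q \<le> epowr (a i) p * epowr S ((q - p) / p)" for i
  proof -
    have "epowr (a i) q = epowr (a i) p * epowr (epowr (a i) p) ((q - p) / p)"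
      using pos False assms by (simp add: epowr_epowr flip: epowr_add)
    also have "\<dots> \<le> epowr (a i) p * epowr S ((q - p) / p)"
      unfolding S_def
      by (intro mult_left_mono epowr_mono pos(1) term_le_suminf_ennreal[where f = "\<lambda>i. epowr (a i) p"]) auto
    finally show ?thesis .
  qed
  then have "(\<Sum>i. epowr (a i) q) \<le> (\<Sum>i. epowr (a i) p * epowr S ((q - p) / p))"
    by (intro suminf_le) auto
  also have "\<dots> = epowr S 1 * epowr S ((q - p) / p)"
    by (simp add: S_def)
  also have "\<dots> = epowr S (q / p)"
    using pos by (subst epowr_add[symmetric]) (auto simp: field_simps)
  finally show ?thesis by (simp add: S_def)
qed

text \<open>
  A substitute, valid for every \<open>p > 0\<close>, for both Minkowski's inequality (\<open>p \<ge> 1\<close>) and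
  subadditivity (\<open>p \<le> 1\<close>), at the price of an exponential weight: if \<open>T\<close> is the weighted sum on the
  right, then \<open>x i \<le> 2\<^bsup>- i e\<^esup> T\<^bsup>1/p\<^esup>\<close>, and these bounds form a geometric series.
\<close>

lemma epowr_suminf_le:
  assumes "0 < e" "0 < p"
  shows "\<exists>C>0. \<forall>x. epowr (\<Sum>i. x i) p \<le> ennreal C * (\<Sum>i. pow2 (real i * e * p) * epowr (x i) p)"
proof -
  obtain B where B: "0 < B" "(\<Sum>i. pow2 (- (real i * e))) = ennreal B"
    using suminf_geometric_pow2[OF assms(1)] .
  have "epowr (\<Sum>i. x i) p \<le> ennreal (B powr p) * (\<Sum>i. pow2 (real i * e * p) * epowr (x i) p)" for x
  proof -
    define T where "T = (\<Sum>i. pow2 (real i * e * p) * epowr (x i) p)"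
    have "x i \<le> pow2 (- (real i * e)) * epowr T (1 / p)" for i
    proof -
      have "pow2 (real i * e * p) * epowr (x i) p \<le> T"
        unfolding T_def by (rule term_le_suminf_ennreal)
      then have "epowr (pow2 (real i * e * p) * epowr (x i) p) (1 / p) \<le> epowr T (1 / p)"
        using assms by (intro epowr_mono) auto
      then have "pow2 (real i * e) * x i \<le> epowr T (1 / p)"
        using assms by (simp add: epowr_mult epowr_pow2 epowr_epowr)
      then have "pow2 (- (real i * e)) * (pow2 (real i * e) * x i) \<le> pow2 (- (real i * e)) * epowr T (1 / p)"
        by (rule mult_left_mono) simp
      then show ?thesis by (simp add: pow2_mult mult.assoc[symmetric])
    qed
    then have "(\<Sum>i. x i) \<le> (\<Sum>i. pow2 (- (real i * e)) * epowr T (1 / p))"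
      by (intro suminf_le) auto
    also have "\<dots> = ennreal B * epowr T (1 / p)" using B by simp
    finally have "epowr (\<Sum>i. x i) p \<le> epowr (ennreal B * epowr T (1 / p)) p"
      using assms by (intro epowr_mono)
    also have "\<dots> = ennreal (B powr p) * T"
      using assms B by (simp add: epowr_mult epowr_epowr epowr_ennreal)
    finally show ?thesis by (simp add: T_def)
  qed
  then show ?thesis using B by (intro exI[of _ "B powr p"]) simp
qed

text \<open>
  The Herz-Morrey norm depends on a function only through the sequence of its norms on the annuli.
  The sum over \<open>k \<le> m\<close> is indexed by the natural number \<open>i = m - k\<close>, which makes it an ordinary
  series.
\<close>

definition herz_morrey_seq :: "real \<Rightarrow> real \<Rightarrow> real \<Rightarrow> (int \<Rightarrow> ennreal) \<Rightarrow> ennreal" where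
  "herz_morrey_seq \<alpha> lam p N =
     (SUP m::int. pow2 (- of_int m * lam) *
        epowr (\<Sum>i. pow2 (of_int (m - int i) * \<alpha> * p) * epowr (N (m - int i)) p) (1 / p))"

lemma herz_morrey_norm_eq_seq:
  "herz_morrey_norm \<alpha> lam p q f =
     herz_morrey_seq \<alpha> lam p (\<lambda>k. var_norm UNIV q (\<lambda>x. indicator (dyadic_annulus k) x *\<^sub>R f x))"
  unfolding herz_morrey_norm_def herz_morrey_seq_def infsum_int_atMost_ennreal ..

lemma herz_morrey_seq_mono:
  assumes "\<And>k. N k \<le> N' k" "0 < p"
  shows "herz_morrey_seq \<alpha> lam p N \<le> herz_morrey_seq \<alpha> lam p N'"
  unfolding herz_morrey_seq_def
  using assms by (intro SUP_mono') (auto intro!: mult_left_mono epowr_mono suminf_le)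

lemma herz_morrey_seq_cmult:
  assumes "0 < p"
  shows "herz_morrey_seq \<alpha> lam p (\<lambda>k. c * N k) = c * herz_morrey_seq \<alpha> lam p N"
proof -
  have "(\<Sum>i. pow2 (of_int (m - int i) * \<alpha> * p) * epowr (c * N (m - int i)) p)
      = epowr c p * (\<Sum>i. pow2 (of_int (m - int i) * \<alpha> * p) * epowr (N (m - int i)) p)" for m
    using assms by (simp add: epowr_mult mult.left_commute flip: ennreal_suminf_cmult)
  then show ?thesis
    using assms unfolding herz_morrey_seq_def
    by (simp add: epowr_mult epowr_epowr SUP_mult_left_ennreal mult.left_commute)
qed

lemma partial_sum_le_herz_morrey_seq:
  assumes "0 < p"
  shows "(\<Sum>i. pow2 (of_int (m - int i) * \<alpha> * p) * epowr (N (m - int i)) p)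
           \<le> pow2 (of_int m * lam * p) * epowr (herz_morrey_seq \<alpha> lam p N) p" (is "?S \<le> _")
proof -
  have "pow2 (- of_int m * lam) * epowr ?S (1 / p) \<le> herz_morrey_seq \<alpha> lam p N"
    unfolding herz_morrey_seq_def by (rule SUP_upper) simp
  then have "epowr (pow2 (- of_int m * lam) * epowr ?S (1 / p)) p \<le> epowr (herz_morrey_seq \<alpha> lam p N) p"
    using assms by (rule epowr_mono)
  then have "pow2 (- (of_int m * lam * p)) * ?S \<le> epowr (herz_morrey_seq \<alpha> lam p N) p"
    using assms by (simp add: epowr_mult epowr_epowr epowr_pow2)
  then have "pow2 (of_int m * lam * p) * (pow2 (- (of_int m * lam * p)) * ?S)
      \<le> pow2 (of_int m * lam * p) * epowr (herz_morrey_seq \<alpha> lam p N) p"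
    by (rule mult_left_mono) simp
  then show ?thesis by (simp add: pow2_mult mult.assoc[symmetric])
qed

lemma herz_morrey_seq_leI:
  assumes "0 < p"
    and "\<And>m. (\<Sum>i. pow2 (of_int (m - int i) * \<alpha> * p) * epowr (N (m - int i)) p)
           \<le> pow2 (of_int m * lam * p) * epowr M p"
  shows "herz_morrey_seq \<alpha> lam p N \<le> M"
  unfolding herz_morrey_seq_def
proof (rule SUP_least)
  fix m :: int
  let ?S = "\<Sum>i. pow2 (of_int (m - int i) * \<alpha> * p) * epowr (N (m - int i)) p"
  have "epowr ?S (1 / p) \<le> epowr (pow2 (of_int m * lam * p) * epowr M p) (1 / p)"
    using assms by (intro epowr_mono) auto
  also have "\<dots> = pow2 (of_int m * lam) * M"
    using assms by (simp add: epowr_mult epowr_epowr epowr_pow2)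
  finally have "pow2 (- of_int m * lam) * epowr ?S (1 / p) \<le> pow2 (- of_int m * lam) * (pow2 (of_int m * lam) * M)"
    by (rule mult_left_mono) simp
  then show "pow2 (- of_int m * lam) * epowr ?S (1 / p) \<le> M"
    by (simp add: pow2_mult mult.assoc[symmetric])
qed

text \<open>
  This is the step that lets the second exponent of summation be larger than the first.
\<close>

lemma herz_morrey_seq_antimono_exponent:
  assumes "0 < p" "p \<le> q"
  shows "herz_morrey_seq \<alpha> lam q N \<le> herz_morrey_seq \<alpha> lam p N" (is "_ \<le> ?M")
proof (rule herz_morrey_seq_leI)
  fix m :: int
  let ?a = "\<lambda>i. pow2 (of_int (m - int i) * \<alpha>) * N (m - int i)"
  have a: "pow2 (of_int (m - int i) * \<alpha> * r) * epowr (N (m - int i)) r = epowr (?a i) r" if "0 < r" for i r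
    using that by (simp add: epowr_mult epowr_pow2)
  have q: "0 < q" using assms by simp
  have "(\<Sum>i. pow2 (of_int (m - int i) * \<alpha> * q) * epowr (N (m - int i)) q) = (\<Sum>i. epowr (?a i) q)"
    using a[OF q] by simp
  also have "\<dots> \<le> epowr (\<Sum>i. epowr (?a i) p) (q / p)"
    using assms by (rule suminf_epowr_le)
  also have "\<dots> \<le> epowr (pow2 (of_int m * lam * p) * epowr ?M p) (q / p)"
    using partial_sum_le_herz_morrey_seq[OF assms(1), of m \<alpha> N lam] a[OF assms(1)] assms
    by (intro epowr_mono) auto
  also have "\<dots> = pow2 (of_int m * lam * q) * epowr ?M q"
    using assms by (simp add: epowr_mult epowr_epowr epowr_pow2 mult.assoc)
  finally show "(\<Sum>i. pow2 (of_int (m - int i) * \<alpha> * q) * epowr (N (m - int i)) q)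
      \<le> pow2 (of_int m * lam * q) * epowr ?M q" .
qed (use assms in simp)

text \<open>
  With \<open>e\<close> half of the gap \<open>lam + d - \<alpha>\<close>, the weighted power inequality for sums turns the \<open>q\<close>-th power
  of the convolution into a double series. Summing first along the diagonals \<open>k - l\<close>, shifted by \<open>l\<close>,
  replaces the top index \<open>m\<close> by \<open>m - l\<close> and so gains \<open>2\<^bsup>- l lam q\<^esup>\<close> from the Morrey factor; what is
  left is a geometric series in \<open>l\<close> with ratio \<open>2\<^bsup>- e q\<^esup>\<close>.
\<close>

lemma herz_morrey_seq_convolution_le:
  assumes "0 < p" "p \<le> q" and "\<alpha> < lam + d"
  shows "\<exists>C>0. \<forall>N. herz_morrey_seq \<alpha> lam q (\<lambda>k. \<Sum>l. pow2 (- (real l * d)) * N (k - int l))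
       \<le> ennreal C * herz_morrey_seq \<alpha> lam p N"
proof -
  define e where "e = (lam + d - \<alpha>) / 2"
  have e: "0 < e" and q: "0 < q" using assms by (auto simp: e_def)
  obtain A where "0 < A \<and>
    (\<forall>x. epowr (\<Sum>i. x i) q \<le> ennreal A * (\<Sum>i. pow2 (real i * e * q) * epowr (x i) q))"
    using epowr_suminf_le[OF e q] by (rule exE)
  note A = conjunct1[OF this] conjunct2[OF this]
  obtain B where B: "0 < B" "(\<Sum>l. pow2 (- (real l * (e * q)))) = ennreal B"
    using suminf_geometric_pow2[OF mult_pos_pos[OF e q]] .
  show ?thesis
  proof (intro exI[of _ "(A * B) powr (1 / q)"] conjI allI)
    show "0 < (A * B) powr (1 / q)" using A B by simp
    fix N :: "int \<Rightarrow> ennreal"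
    define M where "M = herz_morrey_seq \<alpha> lam q N"
    define b where "b k = pow2 (of_int k * \<alpha> * q) * epowr (N k) q" for k
    have b: "(\<Sum>i. b (m - int i)) \<le> pow2 (of_int m * lam * q) * epowr M q" for m
      unfolding b_def M_def using q by (rule partial_sum_le_herz_morrey_seq)
    define J where "J k = (\<Sum>l. pow2 (- (real l * d)) * N (k - int l))" for k
    have J: "pow2 (of_int k * \<alpha> * q) * epowr (J k) q
        \<le> ennreal A * (\<Sum>l. pow2 (real l * q * (e - d + \<alpha>)) * b (k - int l))" for k
    proof -
      have "pow2 (of_int k * \<alpha> * q) * epowr (J k) q \<le> pow2 (of_int k * \<alpha> * q) *
          (ennreal A * (\<Sum>l. pow2 (real l * e * q) * epowr (pow2 (- (real l * d)) * N (k - int l)) q))"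
        unfolding J_def by (intro mult_left_mono A(2)[rule_format]) simp
      also have "\<dots> = ennreal A * (\<Sum>l. pow2 (of_int k * \<alpha> * q) *
          (pow2 (real l * e * q) * epowr (pow2 (- (real l * d)) * N (k - int l)) q))"
        by (simp add: mult.left_commute)
      also have "(\<lambda>l. pow2 (of_int k * \<alpha> * q) *
          (pow2 (real l * e * q) * epowr (pow2 (- (real l * d)) * N (k - int l)) q))
        = (\<lambda>l. pow2 (real l * q * (e - d + \<alpha>)) * b (k - int l))"
        using q by (simp add: fun_eq_iff b_def epowr_mult epowr_pow2 pow2_mult mult.assoc[symmetric])
          (simp add: algebra_simps)
      finally show ?thesis .
    qed
    have "herz_morrey_seq \<alpha> lam q J \<le> ennreal ((A * B) powr (1 / q)) * M"
    proof (rule herz_morrey_seq_leI[OF q])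
      fix m :: int
      have "(\<Sum>i. pow2 (of_int (m - int i) * \<alpha> * q) * epowr (J (m - int i)) q)
          \<le> (\<Sum>i. ennreal A * (\<Sum>l. pow2 (real l * q * (e - d + \<alpha>)) * b (m - int i - int l)))"
        by (intro suminf_le J) auto
      also have "\<dots> = ennreal A * (\<Sum>l. \<Sum>i. pow2 (real l * q * (e - d + \<alpha>)) * b (m - int i - int l))"
        by (subst suminf_swap_ennreal) simp
      also have "\<dots> = ennreal A * (\<Sum>l. pow2 (real l * q * (e - d + \<alpha>)) * (\<Sum>i. b (m - int l - int i)))"
        by (simp add: diff_diff_eq add.commute)
      also have "\<dots> \<le> ennreal A * (\<Sum>l. pow2 (real l * q * (e - d + \<alpha>)) *
          (pow2 (of_int (m - int l) * lam * q) * epowr M q))"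
        by (intro mult_left_mono suminf_le b) auto
      also have "(\<lambda>l. pow2 (real l * q * (e - d + \<alpha>)) * (pow2 (of_int (m - int l) * lam * q) * epowr M q))
          = (\<lambda>l. pow2 (- (real l * (e * q))) * (pow2 (of_int m * lam * q) * epowr M q))"
      proof
        fix l
        have ex: "real l * q * (e - d + \<alpha>) + of_int (m - int l) * lam * q
            = - (real l * (e * q)) + of_int m * lam * q"
          by (simp add: e_def field_simps)
        show "pow2 (real l * q * (e - d + \<alpha>)) * (pow2 (of_int (m - int l) * lam * q) * epowr M q)
          = pow2 (- (real l * (e * q))) * (pow2 (of_int m * lam * q) * epowr M q)"
          unfolding mult.assoc[symmetric] pow2_mult ex ..
      qed
      also have "ennreal A * (\<Sum>l. pow2 (- (real l * (e * q))) * (pow2 (of_int m * lam * q) * epowr M q))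
          = ennreal (A * B) * (pow2 (of_int m * lam * q) * epowr M q)"
        using A B by (simp add: ennreal_mult mult.assoc)
      also have "\<dots> = pow2 (of_int m * lam * q) * epowr (ennreal ((A * B) powr (1 / q)) * M) q"
        using A B q by (simp add: epowr_mult epowr_ennreal powr_powr mult.left_commute)
      finally show "(\<Sum>i. pow2 (of_int (m - int i) * \<alpha> * q) * epowr (J (m - int i)) q)
          \<le> pow2 (of_int m * lam * q) * epowr (ennreal ((A * B) powr (1 / q)) * M) q" .
    qed
    also have "\<dots> \<le> ennreal ((A * B) powr (1 / q)) * herz_morrey_seq \<alpha> lam p N"
      unfolding M_def using assms by (intro mult_left_mono herz_morrey_seq_antimono_exponent) auto
    finally show "herz_morrey_seq \<alpha> lam q (\<lambda>k. \<Sum>l. pow2 (- (real l * d)) * N (k - int l))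
       \<le> ennreal ((A * B) powr (1 / q)) * herz_morrey_seq \<alpha> lam p N"
      unfolding J_def[abs_def] .
  qed
qed

lemma finite_term_of_herz_morrey_seq:
  assumes "0 < p" "herz_morrey_seq \<alpha> lam p N < \<infinity>"
  shows "N k < \<infinity>"
proof -
  have "pow2 (of_int k * \<alpha> * p) * epowr (N k) p
      \<le> (\<Sum>i. pow2 (of_int (k - int i) * \<alpha> * p) * epowr (N (k - int i)) p)"
    using term_le_suminf_ennreal[of "\<lambda>i. pow2 (of_int (k - int i) * \<alpha> * p) * epowr (N (k - int i)) p" 0]
    by simp
  also have "\<dots> \<le> pow2 (of_int k * lam * p) * epowr (herz_morrey_seq \<alpha> lam p N) p"
    using assms(1) by (rule partial_sum_le_herz_morrey_seq)
  also have "\<dots> < \<infinity>"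
    using assms by (auto simp: epowr_def ennreal_mult_less_top)
  finally have "epowr (N k) p \<noteq> \<infinity>" by (auto simp: ennreal_mult_less_top ennreal_mult_top)
  then show ?thesis using epowr_eq_top_iff[of "N k" p] by (auto simp: less_top)
qed

section \<open>Dyadic annuli\<close>

lemma mem_dyadic_annulus_iff:
  "x \<in> dyadic_annulus k \<longleftrightarrow> 2 powr (of_int k - 1) < norm x \<and> norm x \<le> 2 powr of_int k"
proof -
  have "2 powi k = 2 powr real_of_int k" "2 powi (k - 1) = 2 powr (real_of_int k - 1)"
    using powr_real_of_int'[of 2 k] powr_real_of_int'[of 2 "k - 1"] by simp_all
  then show ?thesis by (auto simp: dyadic_annulus_def dyadic_ball_def)
qed

lemma dyadic_annulus_subset_cball: "dyadic_annulus k \<subseteq> cball 0 (2 powr of_int k)"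
  by (auto simp: mem_dyadic_annulus_iff)

lemma dyadic_annulus_measurable [measurable]: "dyadic_annulus k \<in> sets borel"
proof -
  have "dyadic_annulus k = cball 0 (2 powi k) - cball 0 (2 powi (k - 1))"
    by (auto simp: dyadic_annulus_def dyadic_ball_def)
  then show ?thesis by (metis borel_closed closed_cball sets.Diff)
qed

lemma ex_dyadic_annulus:
  assumes "x \<noteq> 0" "norm x \<le> 2 powr of_int k"
  shows "\<exists>i. x \<in> dyadic_annulus (k - int i)"
proof -
  define m where "m = \<lceil>log 2 (norm x)\<rceil>"
  have x: "0 < norm x" using assms by simp
  have "real_of_int m - 1 < log 2 (norm x)" "log 2 (norm x) \<le> real_of_int m"
    unfolding m_def by linarith+
  then have "2 powr (of_int m - 1) < 2 powr log 2 (norm x)" "2 powr log 2 (norm x) \<le> 2 powr of_int m"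
    by simp_all
  then have "x \<in> dyadic_annulus m"
    unfolding powr_log_cancel[OF _ _ x, of 2, simplified] by (simp add: mem_dyadic_annulus_iff)
  moreover have "log 2 (norm x) \<le> of_int k"
    using assms x by (simp add: log_le_iff)
  then have "m \<le> k" unfolding m_def by (simp add: ceiling_le_iff)
  ultimately show ?thesis by (intro exI[of _ "nat (k - m)"]) simp
qed

lemma emeasure_dyadic_annulus_le:
  "emeasure lebesgue (dyadic_annulus k :: (real ^ 'n) set)
     \<le> ennreal (unit_ball_vol (real CARD('n))) * pow2 (of_int k * real CARD('n))"
proof -
  have "emeasure lebesgue (dyadic_annulus k :: (real ^ 'n) set) \<le> emeasure lebesgue (cball (0 :: real ^ 'n) (2 powr of_int k))"
    by (intro emeasure_mono dyadic_annulus_subset_cball) auto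
  also have "\<dots> = ennreal (unit_ball_vol (real CARD('n)) * (2 powr of_int k) ^ CARD('n))"
    by (simp add: emeasure_cball)
  also have "(2 powr of_int k) ^ CARD('n) = 2 powr (of_int k * real CARD('n))"
    by (simp add: powr_powr powr_realpow[symmetric])
  finally show ?thesis by (simp add: ennreal_mult)
qed

section \<open>Norms over a single annulus\<close>

text \<open>
  A form of Young's inequality whose second term carries no conjugate exponent: either \<open>a \<le> M\<close>, or
  \<open>a = a\<^sup>q a\<^bsup>1 - q\<^esup>\<close> with \<open>a\<^bsup>1 - q\<^esup> \<le> M\<^bsup>1 - q\<^esup>\<close>.
\<close>

lemma le_add_powr:
  fixes a M q :: real
  assumes "0 \<le> a" "0 < M" "1 \<le> q"
  shows "a \<le> M + a powr q * M powr (1 - q)"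
proof (cases "a \<le> M")
  case True
  then show ?thesis using assms by (smt (verit) mult_nonneg_nonneg powr_ge_zero)
next
  case False
  then have "a powr (1 - q) \<le> M powr (1 - q)"
    using assms by (intro powr_mono2') auto
  then have "a powr q * a powr (1 - q) \<le> a powr q * M powr (1 - q)"
    by (intro mult_left_mono) auto
  then show ?thesis using False assms by (simp flip: powr_add)
qed

text \<open>
  Hoelder's inequality on an annulus. For admissible \<open>\<eta>\<close> the pointwise inequality
  \<open>a \<le> M + a\<^sup>q M\<^bsup>1 - q\<^esup>\<close> is applied to \<open>a = \<parallel>f\<parallel> / \<eta>\<close> with \<open>M = 2\<^bsup>- j n / s\<^esup>\<close>. This is the choice of \<open>M\<close>
  for which both terms integrate to the same power of two; replacing \<open>q\<close> by \<open>s\<close> in \<open>M\<^bsup>1 - q\<^esup>\<close> costs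
  \<open>2\<^bsup>n D\<^esup>\<close>.
\<close>

lemma nn_integral_annulus_le:
  fixes f :: "real ^ 'n \<Rightarrow> 'b::{banach, second_countable_topology}"
  assumes [measurable]: "f \<in> borel_measurable lebesgue" "q \<in> borel_measurable lebesgue"
    and q: "\<And>x. 1 \<le> q x" and s: "1 \<le> s"
    and D: "\<And>x. x \<in> dyadic_annulus j \<Longrightarrow> \<bar>of_int j\<bar> * \<bar>q x - s\<bar> \<le> D"
  shows "(\<integral>\<^sup>+x\<in>dyadic_annulus j. ennreal (norm (f x)) \<partial>lebesgue)
     \<le> ennreal (unit_ball_vol (real CARD('n)) + 2 powr (real CARD('n) * D))
        * pow2 (of_int j * real CARD('n) * (1 - 1 / s))
        * var_norm UNIV q (\<lambda>x. indicator (dyadic_annulus j) x *\<^sub>R f x)"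
    (is "?I \<le> ennreal (?V + _) * _ * _")
proof -
  let ?n = "real CARD('n)" and ?A = "dyadic_annulus j :: (real ^ 'n) set"
  let ?F = "\<lambda>x. indicator ?A x *\<^sub>R f x"
  have [measurable]: "?A \<in> sets lebesgue" by simp
  define M where "M = 2 powr (- (of_int j * ?n / s))"
  define E where "E = 2 powr (of_int j * ?n * (1 - 1 / s)) * 2 powr (?n * D)"
  define K where "K = (?V + 2 powr (?n * D)) * 2 powr (of_int j * ?n * (1 - 1 / s))"
  have pos: "0 < M" "0 < E" "0 < K" "0 \<le> ?V" by (auto simp: M_def E_def K_def add_nonneg_pos)
  have M_powr: "M powr (1 - q x) \<le> E" if "x \<in> ?A" for x
  proof -
    have "of_int j * (q x - s) \<le> D"
      using D[OF that] abs_ge_self[of "of_int j * (q x - s)"] by (simp add: abs_mult)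
    also have "D \<le> D * s"
      using s order_trans[OF _ D[OF that], of 0] by (simp add: mult_le_cancel_left1)
    finally have "of_int j * (q x - s) / s \<le> D"
      using s by (simp add: pos_divide_le_eq)
    then have "?n * (of_int j * (q x - s) / s) \<le> ?n * D" by (intro mult_left_mono) auto
    moreover have "- (of_int j * ?n / s) * (1 - q x) = of_int j * ?n * (1 - 1 / s) + ?n * (of_int j * (q x - s) / s)"
      using s by (simp add: field_simps)
    ultimately show ?thesis
      unfolding M_def E_def powr_powr powr_add[symmetric] by (intro powr_mono) auto
  qed
  have "?I \<le> ennreal K * ennreal \<eta>" if \<eta>: "0 < \<eta>" "var_modular UNIV q \<eta> ?F \<le> 1" for \<eta>
  proof -
    have pw: "ennreal (norm (f x)) * indicator ?A x
        \<le> ennreal \<eta> * (ennreal M * indicator ?A x + ennreal E * ennreal ((norm (?F x) / \<eta>) powr q x))" for x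
    proof (cases "x \<in> ?A")
      case True
      have "norm (f x) / \<eta> \<le> M + (norm (f x) / \<eta>) powr q x * M powr (1 - q x)"
        using \<eta> pos q by (intro le_add_powr) auto
      also have "\<dots> \<le> M + (norm (f x) / \<eta>) powr q x * E"
        using M_powr[OF True] by (intro add_left_mono mult_left_mono) auto
      finally have "norm (f x) \<le> \<eta> * (M + E * (norm (f x) / \<eta>) powr q x)"
        using \<eta> by (simp add: field_simps)
      then show ?thesis
        using True \<eta> pos by (simp flip: ennreal_mult' ennreal_plus)
    qed simp
    have "?I \<le> (\<integral>\<^sup>+x. ennreal \<eta> * (ennreal M * indicator ?A x + ennreal E * ennreal ((norm (?F x) / \<eta>) powr q x)) \<partial>lebesgue)"
      by (intro nn_integral_mono pw)
    also have "\<dots> = ennreal \<eta> * (ennreal M * emeasure lebesgue ?A + ennreal E * var_modular UNIV q \<eta> ?F)"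
      unfolding var_modular_def by (simp add: nn_integral_cmult nn_integral_add)
    also have "\<dots> \<le> ennreal \<eta> * (ennreal M * (ennreal ?V * pow2 (of_int j * ?n)) + ennreal E * 1)"
      by (intro mult_left_mono add_mono emeasure_dyadic_annulus_le \<eta>) auto
    also have "\<dots> = ennreal (\<eta> * (M * (?V * 2 powr (of_int j * ?n)) + E))"
      using pos \<eta> by (simp flip: ennreal_mult' ennreal_plus)
    also have "M * (?V * 2 powr (of_int j * ?n)) + E = K"
    proof -
      have "M * 2 powr (of_int j * ?n) = 2 powr (of_int j * ?n * (1 - 1 / s))"
        unfolding M_def by (simp add: algebra_simps flip: powr_add)
      then show ?thesis by (simp add: K_def E_def algebra_simps)
    qed
    finally show ?thesis using pos \<eta> by (simp add: ennreal_mult mult.commute)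
  qed
  then have "?I / ennreal K \<le> var_norm UNIV q ?F"
    unfolding var_norm_def using pos by (intro INF_greatest divide_le_posI_ennreal) auto
  then have "ennreal K * (?I / ennreal K) \<le> ennreal K * var_norm UNIV q ?F"
    by (rule mult_left_mono) simp
  also have "ennreal K * (?I / ennreal K) = ?I"
    using pos by (simp add: ennreal_times_divide mult.commute[of "ennreal K"] ennreal_mult_divide_eq)
  finally have "?I \<le> ennreal K * var_norm UNIV q ?F" .
  then show ?thesis using pos by (simp add: K_def ennreal_mult)
qed

text \<open>
  Raising \<open>2\<^bsup>k (b - n / s)\<^esup>\<close> to the power \<open>r\<close> and inserting \<open>b = n/q - n/r\<close> gives \<open>2\<^bsup>- k n\<^esup>\<close> times
  \<open>2\<^bsup>k n r (1/q - 1/s)\<^esup>\<close>. The first factor cancels the measure of the annulus and the second is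
  bounded, so \<open>b\<close> disappears from the modular without any continuity.
\<close>

lemma var_norm_annulus_le:
  fixes g :: "real ^ 'n \<Rightarrow> 'b::{banach, second_countable_topology}"
  assumes q: "\<And>x. 1 \<le> q x" and s: "1 \<le> s" and D: "0 \<le> D"
    "\<And>x. x \<in> dyadic_annulus k \<Longrightarrow> \<bar>of_int k\<bar> * \<bar>q x - s\<bar> \<le> D"
    and b: "\<And>x. 0 \<le> b x" "\<And>x. b x \<le> real CARD('n)"
    and r: "\<And>x. 1 / r x = 1 / q x - b x / real CARD('n)"
    and rR: "AE x in lebesgue. 1 \<le> r x \<and> r x \<le> R"
    and g: "\<And>x. x \<in> dyadic_annulus k \<Longrightarrow> ennreal (norm (g x)) \<le> ennreal (norm x powr (b x - real CARD('n))) * I"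
  shows "var_norm UNIV r (\<lambda>x. indicator (dyadic_annulus k) x *\<^sub>R g x)
     \<le> ennreal (2 powr (real CARD('n)) * (unit_ball_vol (real CARD('n)) * 2 powr (real CARD('n) * R * D) + 1))
        * pow2 (- of_int k * real CARD('n) * (1 - 1 / s)) * I"
proof -
  let ?n = "real CARD('n)" and ?A = "dyadic_annulus k :: (real ^ 'n) set"
  let ?V = "unit_ball_vol ?n"
  let ?G = "\<lambda>x. indicator ?A x *\<^sub>R g x"
  define L where "L = ?V * 2 powr (?n * R * D) + 1"
  have L: "1 \<le> L" "0 \<le> ?V" by (auto simp: L_def)
  define K where "K = 2 powr ?n * L * 2 powr (- of_int k * ?n * (1 - 1 / s))"
  have K: "0 < K" using L by (auto simp: K_def)
  show ?thesis
  proof (cases "I = \<infinity>")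
    case True
    moreover have "ennreal (2 powr ?n * L) * pow2 (- of_int k * ?n * (1 - 1 / s)) = ennreal K"
      using L by (simp add: K_def ennreal_mult)
    ultimately show ?thesis using K by (simp add: L_def ennreal_mult_top)
  next
    case False
    then obtain J where J: "I = ennreal J" "0 \<le> J" by (cases I) auto
    have mod: "var_modular UNIV r (K * J') ?G \<le> 1" if J': "0 < J'" "J \<le> J'" for J'
    proof -
      have pw: "ennreal ((norm (?G x) / (K * J')) powr r x)
          \<le> ennreal (2 powr (?n * R * D) / L * 2 powr (- (of_int k * ?n))) * indicator ?A x"
        if rx: "1 \<le> r x" "r x \<le> R" for x
      proof (cases "x \<in> ?A")
        case True
        then have nx: "2 powr (of_int k - 1) \<le> norm x" "0 < norm x"
          by (auto simp: mem_dyadic_annulus_iff intro: less_trans[of 0 "2 powr (of_int k - 1)"])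
        have "norm (g x) \<le> norm x powr (b x - ?n) * J"
          using g[OF True] J by (simp flip: ennreal_mult)
        also have "\<dots> \<le> (2 powr (of_int k - 1)) powr (b x - ?n) * J'"
          using J J' b nx by (intro mult_mono powr_mono2') auto
        \<comment> \<open>Passing from the inner radius \<open>2\<^bsup>k - 1\<^esup>\<close> to \<open>2\<^sup>k\<close> costs \<open>2\<^bsup>n - b\<^esup> \<le> 2\<^sup>n\<close>.\<close>
        also have "(2 powr (of_int k - 1)) powr (b x - ?n) \<le> 2 powr (?n + of_int k * (b x - ?n))"
          using b(1)[of x] unfolding powr_powr by (intro powr_mono) (auto simp: algebra_simps)
        finally have "norm (g x) \<le> 2 powr (?n + of_int k * (b x - ?n)) * J'"
          using J' by (simp add: mult_right_mono)
        then have "norm (g x) / (K * J') \<le> 2 powr (?n + of_int k * (b x - ?n)) / K"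
          using K J' by (simp add: field_simps)
        also have "\<dots> = 2 powr (of_int k * (b x - ?n / s)) / L"
        proof -
          have "K = L * 2 powr (?n - of_int k * ?n * (1 - 1 / s))"
            by (simp add: K_def powr_add[symmetric] mult.commute mult.left_commute)
          moreover have "?n + of_int k * (b x - ?n) = (?n - of_int k * ?n * (1 - 1 / s)) + of_int k * (b x - ?n / s)"
            by (simp add: algebra_simps)
          ultimately show ?thesis by (simp only: powr_add) simp
        qed
        finally have "(norm (g x) / (K * J')) powr r x \<le> (2 powr (of_int k * (b x - ?n / s)) / L) powr r x"
          using K J' rx by (intro powr_mono2) auto
        also have "\<dots> = 2 powr (of_int k * (b x - ?n / s) * r x) / L powr r x"
          using L by (simp add: powr_divide powr_powr)
        also have "\<dots> \<le> 2 powr (?n * R * D - of_int k * ?n) / L"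
        proof (intro frac_le powr_mono)
          have br: "b x * r x = ?n * (r x * (1 / q x)) - ?n"
            using r[of x] rx q[of x] by (simp add: field_simps)
          have "of_int k * (b x - ?n / s) * r x = of_int k * (b x * r x) - of_int k * ?n / s * r x"
            by (simp add: algebra_simps)
          also have "\<dots> = ?n * (r x * (of_int k * (1 / q x - 1 / s))) - of_int k * ?n"
            unfolding br by (simp add: algebra_simps)
          finally have eq: "of_int k * (b x - ?n / s) * r x = ?n * (r x * (of_int k * (1 / q x - 1 / s))) - of_int k * ?n" .
          have "of_int k * (1 / q x - 1 / s) \<le> \<bar>of_int k\<bar> * \<bar>1 / q x - 1 / s\<bar>"
            using abs_ge_self[of "of_int k * (1 / q x - 1 / s)"] by (simp add: abs_mult)
          also have "\<bar>1 / q x - 1 / s\<bar> \<le> \<bar>q x - s\<bar>"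
          proof -
            have "\<bar>1 / q x - 1 / s\<bar> = \<bar>q x - s\<bar> / (q x * s)"
              using q[of x] s by (simp add: diff_frac_eq abs_minus_commute abs_mult)
            also have "\<dots> \<le> \<bar>q x - s\<bar> / 1"
              using mult_mono[of 1 "q x" 1 s] q[of x] s by (intro divide_left_mono) auto
            finally show ?thesis by simp
          qed
          then have "\<bar>of_int k\<bar> * \<bar>1 / q x - 1 / s\<bar> \<le> \<bar>of_int k\<bar> * \<bar>q x - s\<bar>" by (intro mult_left_mono) auto
          also have "\<dots> \<le> D" using D(2)[OF True] .
          finally have "r x * (of_int k * (1 / q x - 1 / s)) \<le> R * D"
            using rx D(1) by (smt (verit) mult_left_mono mult_right_mono)
          then show "of_int k * (b x - ?n / s) * r x \<le> ?n * R * D - of_int k * ?n"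
            unfolding eq by (simp add: mult.assoc)
          show "L \<le> L powr r x" using powr_mono[of 1 "r x" L] L rx by simp
        qed (use L in auto)
        finally show ?thesis
          using True by (simp add: powr_diff powr_minus_divide mult.commute ennreal_leI)
      qed (use rx in simp)
      have "var_modular UNIV r (K * J') ?G
          \<le> (\<integral>\<^sup>+x. ennreal (2 powr (?n * R * D) / L * 2 powr (- (of_int k * ?n))) * indicator ?A x \<partial>lebesgue)"
        unfolding var_modular_def indicator_UNIV mult_1_right
        by (rule nn_integral_mono_AE, use rR in eventually_elim) (blast intro: pw)
      also have "\<dots> = ennreal (2 powr (?n * R * D) / L * 2 powr (- (of_int k * ?n))) * emeasure lebesgue ?A"
        by (subst nn_integral_cmult_indicator) auto
      also have "\<dots> \<le> ennreal (2 powr (?n * R * D) / L * 2 powr (- (of_int k * ?n))) * (ennreal ?V * pow2 (of_int k * ?n))"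
        by (intro mult_left_mono emeasure_dyadic_annulus_le) auto
      also have "\<dots> = ennreal (2 powr (?n * R * D) / L * ?V * (2 powr (- (of_int k * ?n)) * 2 powr (of_int k * ?n)))"
        using L by (simp flip: ennreal_mult' add: mult_ac)
      also have "\<dots> \<le> 1"
        using L by (simp flip: powr_add add: divide_le_eq) (simp add: L_def mult.commute)
      finally show ?thesis .
    qed
    have "var_norm UNIV r ?G \<le> ennreal (K * J)"
    proof (rule ennreal_le_epsilon)
      \<comment> \<open>\<open>K * J\<close> itself is not an admissible value when \<open>J = 0\<close>, hence the approximation from above.\<close>
      fix e :: real assume "0 < e"
      then have J': "0 < J + e / K" "J \<le> J + e / K" using J K by (auto simp: add_nonneg_pos)
      have "var_norm UNIV r ?G \<le> ennreal (K * (J + e / K))"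
        unfolding var_norm_def using mod[OF J'] J' K by (intro INF_lower) auto
      also have "\<dots> = ennreal (K * J) + ennreal e"
        using J K \<open>0 < e\<close> by (simp add: distrib_left flip: ennreal_plus)
      finally show "var_norm UNIV r ?G \<le> ennreal (K * J) + ennreal e" .
    qed
    then show ?thesis using J K L by (simp add: K_def L_def ennreal_mult)
  qed
qed

section \<open>Consequences of the hypotheses on the exponents\<close>

lemma tendsto_at_infty:
  assumes "q \<in> log_hoelder_class"
  shows "(q \<longlongrightarrow> at_infty q) at_infinity"
proof -
  obtain l where l: "(q \<longlongrightarrow> l) at_infinity" using assms by (auto simp: log_hoelder_class_def)
  then have "Lim at_infinity q = l" by (intro tendsto_Lim trivial_limit_at_infinity)
  then show ?thesis using l by (simp add: at_infty_def)
qed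

text \<open>
  For \<open>k < 0\<close> the local condition is used with the reference point \<open>0\<close>, since \<open>- ln \<bar>x\<bar> \<ge> \<bar>k\<bar> ln 2\<close>; for
  \<open>k > 0\<close> the decay condition at infinity is used, since \<open>ln (e + \<bar>x\<bar>)\<close> is at least a multiple of \<open>k\<close>.
\<close>

lemma log_hoelder_annulus_bound:
  fixes q :: "real ^ 'n \<Rightarrow> real"
  assumes "q \<in> log_hoelder_class"
  shows "\<exists>D\<ge>0. \<forall>k. \<forall>x \<in> dyadic_annulus k. \<bar>of_int k\<bar> * \<bar>q x - (if k \<le> 0 then q 0 else at_infty q)\<bar> \<le> D"
proof -
  obtain C where C: "0 < C" "\<And>x y. norm (x - y) \<le> 1 / 2 \<Longrightarrow> \<bar>q x - q y\<bar> \<le> - C / ln (norm (x - y))"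
    using assms by (auto simp: log_hoelder_class_def)
  obtain C' where C': "0 < C'" "\<And>x. \<bar>q x - at_infty q\<bar> \<le> C' / ln (exp 1 + norm x)"
    using assms by (auto simp: log_hoelder_class_def)
  have ln2: "0 < ln (2::real)" by simp
  have small: "\<bar>of_int k\<bar> * \<bar>q x - q 0\<bar> \<le> C / ln 2" if x: "x \<in> dyadic_annulus k" and k: "k < 0" for k x
  proof -
    have nx: "0 < norm x" "norm x \<le> 2 powr of_int k"
      using x by (auto simp: mem_dyadic_annulus_iff intro: less_trans[of 0 "2 powr (of_int k - 1)"])
    have "2 powr of_int k \<le> (2::real) powr (-1)" using k by (intro powr_mono) auto
    then have "norm (x - 0) \<le> 1 / 2" using nx by (simp add: powr_minus)
    then have q0: "\<bar>q x - q 0\<bar> \<le> C / (- ln (norm x))"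
      using C(2)[of x 0] by simp
    have "ln (norm x) \<le> of_int k * ln 2"
      using ln_mono[OF nx(2,1)] by (simp add: ln_powr)
    then have "\<bar>of_int k\<bar> * ln 2 \<le> - ln (norm x)" using k by simp
    moreover have "0 < \<bar>of_int k :: real\<bar> * ln 2" using k by (intro mult_pos_pos) auto
    ultimately have "C / (- ln (norm x)) \<le> C / (\<bar>of_int k\<bar> * ln 2)"
      using C(1) by (intro frac_le) linarith+
    with q0 have "\<bar>q x - q 0\<bar> \<le> C / (\<bar>of_int k\<bar> * ln 2)" by (rule order_trans)
    from mult_left_mono[OF this, of "\<bar>of_int k\<bar>"] show ?thesis using k by simp
  qed
  have large: "\<bar>of_int k\<bar> * \<bar>q x - at_infty q\<bar> \<le> C' * (1 + 1 / ln 2)" if x: "x \<in> dyadic_annulus k" and k: "0 < k" for k x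
  proof -
    let ?L = "ln (exp 1 + norm x)"
    have nx: "2 powr (of_int k - 1) < norm x" using x by (simp add: mem_dyadic_annulus_iff)
    have L1: "1 \<le> ?L" using ln_mono[of "exp 1" "exp 1 + norm x"] by simp
    have "2 powr (of_int k - 1) \<le> exp 1 + norm x" using nx by (smt (verit) exp_gt_zero)
    then have "(of_int k - 1) * ln 2 \<le> ?L"
      using ln_mono[of "2 powr (of_int k - 1)" "exp 1 + norm x"] by (simp add: ln_powr add_pos_nonneg)
    then have "of_int k - 1 \<le> ?L / ln 2" using ln2 by (simp add: field_simps)
    then have k': "of_int k \<le> ?L * (1 + 1 / ln 2)" using L1 by (simp add: algebra_simps)
    have "\<bar>of_int k\<bar> * \<bar>q x - at_infty q\<bar> \<le> of_int k * (C' / ?L)"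
      using mult_left_mono[OF C'(2)[of x], of "of_int k"] k by simp
    also have "\<dots> \<le> (?L * (1 + 1 / ln 2)) * (C' / ?L)"
      using k' C'(1) L1 by (intro mult_right_mono) auto
    also have "\<dots> = C' * (1 + 1 / ln 2)" using L1 by simp
    finally show ?thesis .
  qed
  have bound: "\<bar>of_int k\<bar> * \<bar>q x - (if k \<le> 0 then q 0 else at_infty q)\<bar> \<le> max (C / ln 2) (C' * (1 + 1 / ln 2))"
    if "x \<in> dyadic_annulus k" for k x
  proof -
    consider "k < 0" | "k = 0" | "0 < k" by linarith
    then show ?thesis
    proof cases
      case 1 then show ?thesis using small[OF that] by simp
    next
      case 2 then show ?thesis using C(1) by (simp add: le_max_iff_disj)
    next
      case 3 then show ?thesis using large[OF that] by simp
    qed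
  qed
  show ?thesis
  proof (intro exI[of _ "max (C / ln 2) (C' * (1 + 1 / ln 2))"] conjI allI ballI bound)
    show "0 \<le> max (C / ln 2) (C' * (1 + 1 / ln 2))" using C(1) by (simp add: le_max_iff_disj)
  qed
qed

lemma not_AE_lebesgue_bounded: "\<not> (AE x :: real ^ 'n in lebesgue. norm x < R)"
proof
  assume "AE x :: real ^ 'n in lebesgue. norm x < R"
  then have "emeasure lebesgue (UNIV :: (real ^ 'n) set) = emeasure lebesgue (cball (0 :: real ^ 'n) R)"
    by (intro emeasure_eq_AE) (auto elim!: eventually_mono)
  moreover have "emeasure lebesgue (cball (0 :: real ^ 'n) R) < \<infinity>"
    using emeasure_lborel_cball_finite[of "0 :: real ^ 'n" R] by simp
  ultimately show False by simp
qed

text \<open>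
  The conjugate exponent tends to \<open>c / (c - 1)\<close> at infinity, and a neighbourhood of infinity has
  positive measure, so its essential supremum is at least this limit.
\<close>

lemma le_of_less_inverse_ess_sup_conj_exponent:
  fixes q :: "real ^ 'n \<Rightarrow> real"
  assumes lim: "(q \<longlongrightarrow> c) at_infinity" and c: "1 < c"
    and d: "0 < d" "ereal d < 1 / ess_sup (conj_exponent q)"
  shows "d \<le> 1 - 1 / c"
proof (rule ccontr)
  assume "\<not> ?thesis"
  then have "1 / d < c / (c - 1)" using c d by (simp add: field_simps)
  moreover have "(conj_exponent q \<longlongrightarrow> c / (c - 1)) at_infinity"
    unfolding conj_exponent_def using c by (intro tendsto_intros lim) auto
  ultimately have "eventually (\<lambda>x. 1 / d < conj_exponent q x) at_infinity"
    by (rule order_tendstoD(1)[rotated])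
  then obtain R where R: "\<And>x. R \<le> norm x \<Longrightarrow> 1 / d < conj_exponent q x"
    by (auto simp: eventually_at_infinity)
  have "ereal (1 / d) \<le> ess_sup (conj_exponent q)"
  proof (rule ccontr)
    assume less: "\<not> ?thesis"
    have "AE x in lebesgue. ereal (conj_exponent q x) \<le> ess_sup (conj_exponent q)"
      unfolding ess_sup_def by (rule esssup_AE)
    then have "AE x :: real ^ 'n in lebesgue. norm x < R"
    proof (eventually_elim)
      case (elim x)
      moreover have "ess_sup (conj_exponent q) < ereal (1 / d)" using less by (simp add: not_le)
      ultimately have "ereal (conj_exponent q x) < ereal (1 / d)" by (rule le_less_trans)
      then show ?case using R[of x] by (cases "R \<le> norm x") auto
    qed
    then show False using not_AE_lebesgue_bounded by blast
  qed
  then have "1 / ess_sup (conj_exponent q) \<le> ereal d"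
  proof (cases "ess_sup (conj_exponent q)")
    case (real e)
    then have "1 / d \<le> e" using \<open>ereal (1 / d) \<le> ess_sup (conj_exponent q)\<close> by simp
    moreover from this have "0 < e" using d(1) by (meson less_le_trans zero_less_divide_1_iff)
    ultimately have "1 / e \<le> d" using d(1) by (simp add: field_simps)
    then show ?thesis using real \<open>0 < e\<close> by (simp add: one_ereal_def)
  qed (use d(1) \<open>ereal (1 / d) \<le> ess_sup (conj_exponent q)\<close> in auto)
  then show False using d(2) by simp
qed

lemma AE_less_of_ess_sup_less:
  assumes "ess_sup h < ereal c"
  shows "\<exists>s<c. AE x in lebesgue. h x \<le> s"
proof -
  obtain s where s: "ess_sup h < ereal s" "s < c" using ereal_dense2[OF assms] by auto
  have "AE x in lebesgue. ereal (h x) \<le> ess_sup h" unfolding ess_sup_def by (rule esssup_AE)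
  then have "AE x in lebesgue. h x \<le> s"
    using s(1) by (auto elim!: eventually_mono) (metis ereal_less_eq(3) less_imp_le order_trans)
  then show ?thesis using s(2) by blast
qed

text \<open>
  Since \<open>1 / r = (1 - q b / n) / q\<close>, keeping \<open>q b\<close> away from \<open>n\<close> keeps \<open>r\<close> positive and bounded. On the
  exceptional null set \<open>r\<close> may be zero or negative.
\<close>

lemma AE_sobolev_exponent_bounds:
  fixes q r b :: "real ^ 'n \<Rightarrow> real"
  assumes q: "\<And>x. 1 \<le> q x" "\<And>x. q x \<le> Q" and b: "\<And>x. 0 \<le> b x"
    and r: "\<And>x. 1 / r x = 1 / q x - b x / real CARD('n)"
    and qb: "ess_sup (\<lambda>x. q x * b x) < ereal (real CARD('n))"
  shows "\<exists>R. AE x in lebesgue. 1 \<le> r x \<and> r x \<le> R"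
proof -
  let ?n = "real CARD('n)"
  obtain s where s: "s < ?n" "AE x in lebesgue. q x * b x \<le> s"
    using AE_less_of_ess_sup_less[OF qb] by blast
  have "1 \<le> r x \<and> r x \<le> Q / (1 - s / ?n)" if qs: "q x * b x \<le> s" for x
  proof -
    define t where "t = 1 - s / ?n"
    have t: "0 < t" using s by (simp add: t_def)
    have q0: "0 < q x" "0 < Q" using q[of x] by auto
    have "1 / r x = (1 - q x * b x / ?n) / q x" using r[of x] q0 by (simp add: field_simps)
    moreover have "t \<le> 1 - q x * b x / ?n" using qs by (simp add: t_def divide_right_mono)
    ultimately have "t / q x \<le> 1 / r x" using q0 by (simp add: divide_right_mono)
    moreover have "t / Q \<le> t / q x" using q0 q(2)[of x] t by (intro divide_left_mono) auto
    ultimately have lower: "t / Q \<le> 1 / r x" by linarith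
    then have "0 < 1 / r x" using t q0 by (smt (verit) divide_pos_pos)
    then have r0: "0 < r x" by simp
    have "1 / r x \<le> 1 / q x" using r[of x] b[of x] by simp
    also have "\<dots> \<le> 1" using q(1)[of x] by simp
    finally have "1 \<le> r x" using r0 by simp
    moreover have "r x \<le> Q / t" using lower r0 t q0 by (simp add: field_simps)
    ultimately show ?thesis by (simp add: t_def)
  qed
  then show ?thesis using s(2) by (intro exI[of _ "Q / (1 - s / ?n)"]) (auto elim!: eventually_mono)
qed

text \<open>
  The exponent of the combined kernel: between two annuli the power of two decays at least at rate \<open>d\<close>
  per step, also when the step crosses from the regime of the origin (\<open>u\<close>) to that of infinity (\<open>v\<close>).
\<close>

lemma annulus_exponent_diff_le:
  fixes k :: int and u v d :: real
  assumes "d \<le> v" "v \<le> u"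
  shows "of_int (k - int i) * (if k - int i \<le> 0 then u else v) - of_int k * (if k \<le> 0 then u else v) \<le> - (real i * d)"
proof -
  have 1: "real i * d \<le> real i * u" "real i * d \<le> real i * v"
    using assms by (auto intro!: mult_left_mono)
  show ?thesis
  proof (cases "0 < k \<and> k - int i \<le> 0")
    case True
    then have "of_int (k - int i) \<le> (0 :: real)" by (simp only: of_int_le_0_iff)
    then have "(real i - of_int k) * d \<le> (real i - of_int k) * u" "of_int k * d \<le> of_int k * v"
      using assms True by (auto intro!: mult_left_mono)
    then have "- ((real i - of_int k) * u) - of_int k * v \<le> - ((real i - of_int k) * d) - of_int k * d"
      by linarith
    then show ?thesis using True by (simp add: left_diff_distrib)
  next
    case False
    then show ?thesis using 1 by (auto simp: algebra_simps)
  qed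
qed

section \<open>Integrals over balls centred at the origin\<close>

lemma norm_set_integral_le_nn_integral:
  fixes f :: "'a \<Rightarrow> 'b::{banach, second_countable_topology}"
  shows "ennreal (norm (LINT t:S|M. f t)) \<le> (\<integral>\<^sup>+t\<in>S. ennreal (norm (f t)) \<partial>M)"
proof (cases "integrable M (\<lambda>t. indicator S t *\<^sub>R f t)")
  case True
  then have "ennreal (norm (LINT t:S|M. f t)) \<le> (\<integral>\<^sup>+t. ennreal (norm (indicator S t *\<^sub>R f t)) \<partial>M)"
    unfolding set_lebesgue_integral_def by (rule integral_norm_bound_ennreal)
  also have "\<dots> = (\<integral>\<^sup>+t\<in>S. ennreal (norm (f t)) \<partial>M)"
    by (intro nn_integral_cong) (auto split: split_indicator)
  finally show ?thesis .
next
  case False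
  then show ?thesis by (simp add: set_lebesgue_integral_def not_integrable_integral_eq)
qed

text \<open>
  The integral is a left-continuous function of the radius. Rounding \<open>m \<bar>x\<bar>\<close> up and subtracting one
  gives radii strictly below \<open>\<bar>x\<bar>\<close> that take countably many values and converge to \<open>\<bar>x\<bar>\<close>, so it is a
  pointwise limit of countably valued measurable functions.
\<close>

lemma borel_measurable_integral_ball:
  fixes f :: "real ^ 'n \<Rightarrow> 'b::{banach, second_countable_topology}"
  assumes [measurable]: "f \<in> borel_measurable lebesgue"
    and fin: "\<And>R. (\<integral>\<^sup>+t\<in>cball 0 R. ennreal (norm (f t)) \<partial>lebesgue) < \<infinity>"
  shows "(\<lambda>x :: real ^ 'n. LINT t:{t. norm t < norm x}|lebesgue. f t) \<in> borel_measurable lebesgue"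
proof -
  define F where "F r = (LINT t:{t. norm t < r}|lebesgue. f t)" for r :: real
  define \<rho> where "\<rho> m r = (real_of_int \<lceil>real (Suc m) * r\<rceil> - 1) / real (Suc m)" for m r
  have \<rho>_less: "\<rho> m r < r" and \<rho>_ge: "r - 1 / real (Suc m) \<le> \<rho> m r" for m r
    unfolding \<rho>_def by (simp_all add: field_simps del: of_nat_Suc) linarith+
  have lim: "(\<lambda>m. \<rho> m r) \<longlonglongrightarrow> r" for r
  proof (rule tendsto_sandwich[OF _ _ _ tendsto_const])
    show "(\<lambda>m. r - 1 / real (Suc m)) \<longlonglongrightarrow> r"
      using tendsto_diff[OF tendsto_const[of r] LIMSEQ_inverse_real_of_nat] by (simp add: inverse_eq_divide)
  qed (use \<rho>_less \<rho>_ge in \<open>auto intro!: always_eventually less_imp_le\<close>)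
  have ball [measurable]: "{t :: real ^ 'n. norm t < r} \<in> sets lebesgue" for r
  proof -
    have "{t :: real ^ 'n. norm t < r} = ball 0 r" by auto
    then show ?thesis by simp
  qed
  have [measurable]: "cball (0 :: real ^ 'n) r \<in> sets lebesgue" for r by simp
  have step_lim: "(\<lambda>m. F (\<rho> m r)) \<longlonglongrightarrow> F r" for r
    unfolding F_def set_lebesgue_integral_def
  proof (rule integral_dominated_convergence[where w = "\<lambda>t. norm (indicator (cball 0 r) t *\<^sub>R f t)"])
    show "integrable lebesgue (\<lambda>t. norm (indicator (cball 0 r) t *\<^sub>R f t))"
    proof (rule integrable_norm, rule integrableI_bounded)
      have "(\<integral>\<^sup>+t. ennreal (norm (indicator (cball 0 r) t *\<^sub>R f t)) \<partial>lebesgue)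
          = (\<integral>\<^sup>+t\<in>cball 0 r. ennreal (norm (f t)) \<partial>lebesgue)"
        by (intro nn_integral_cong) (auto split: split_indicator)
      then show "(\<integral>\<^sup>+t. ennreal (norm (indicator (cball 0 r) t *\<^sub>R f t)) \<partial>lebesgue) < \<infinity>"
        using fin by simp
    qed measurable
    show "AE t in lebesgue. (\<lambda>m. indicator {t. norm t < \<rho> m r} t *\<^sub>R f t) \<longlonglongrightarrow> indicator {t. norm t < r} t *\<^sub>R f t"
    proof (rule AE_I2)
      fix t :: "real ^ 'n"
      have "eventually (\<lambda>m. indicator {t. norm t < \<rho> m r} t *\<^sub>R f t = indicator {t. norm t < r} t *\<^sub>R f t) sequentially"
      proof (cases "norm t < r")
        case True
        then show ?thesis using order_tendstoD(1)[OF lim True] by (auto elim!: eventually_mono)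
      next
        case False
        then have "\<not> norm t < \<rho> m r" for m using \<rho>_less[where m = m and r = r] by linarith
        then show ?thesis using False by simp
      qed
      then show "(\<lambda>m. indicator {t. norm t < \<rho> m r} t *\<^sub>R f t) \<longlonglongrightarrow> indicator {t. norm t < r} t *\<^sub>R f t"
        by (rule tendsto_eventually)
    qed
    show "AE t in lebesgue. norm (indicator {t. norm t < \<rho> m r} t *\<^sub>R f t) \<le> norm (indicator (cball 0 r) t *\<^sub>R f t)" for m
      using \<rho>_less[where m = m and r = r] by (intro AE_I2) (auto split: split_indicator)
  qed auto
  have step_meas: "(\<lambda>x :: real ^ 'n. F (\<rho> m (norm x))) \<in> borel_measurable lebesgue" for m
  proof -
    have "(\<lambda>x :: real ^ 'n. \<lceil>real (Suc m) * norm x\<rceil>) \<in> borel \<rightarrow>\<^sub>M count_space UNIV"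
      by measurable
    then have "(\<lambda>x :: real ^ 'n. \<lceil>real (Suc m) * norm x\<rceil>) \<in> lebesgue \<rightarrow>\<^sub>M count_space UNIV"
      by (intro measurable_completion) simp
    then show ?thesis unfolding \<rho>_def
      by (rule measurable_compose_countable[rotated]) simp
  qed
  show ?thesis
    unfolding F_def[symmetric] by (rule borel_measurable_LIMSEQ_metric[OF step_meas step_lim])
qed

lemma nn_integral_cball_le_suminf_annuli:
  fixes h :: "real ^ 'n \<Rightarrow> ennreal"
  assumes [measurable]: "h \<in> borel_measurable lebesgue"
  shows "(\<integral>\<^sup>+t\<in>cball 0 (2 powr of_int k). h t \<partial>lebesgue) \<le> (\<Sum>i. \<integral>\<^sup>+t\<in>dyadic_annulus (k - int i). h t \<partial>lebesgue)"
proof -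
  have [measurable]: "dyadic_annulus j \<in> sets (lebesgue :: (real ^ 'n) measure)" for j by simp
  have "AE t :: real ^ 'n in lebesgue. t \<noteq> 0"
    by (rule AE_I'[where N = "{0}"]) auto
  then have "AE t in lebesgue. h t * indicator (cball 0 (2 powr of_int k)) t \<le> (\<Sum>i. h t * indicator (dyadic_annulus (k - int i)) t)"
  proof eventually_elim
    case (elim t)
    show ?case
    proof (cases "norm t \<le> 2 powr of_int k")
      case True
      then obtain i where "t \<in> dyadic_annulus (k - int i)" using ex_dyadic_annulus[OF elim] by blast
      then show ?thesis
        using True term_le_suminf_ennreal[of "\<lambda>i. h t * indicator (dyadic_annulus (k - int i)) t" i] by simp
    qed simp
  qed
  then have "(\<integral>\<^sup>+t\<in>cball 0 (2 powr of_int k). h t \<partial>lebesgue) \<le> (\<integral>\<^sup>+t. (\<Sum>i. h t * indicator (dyadic_annulus (k - int i)) t) \<partial>lebesgue)"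
    by (rule nn_integral_mono_AE)
  also have "\<dots> = (\<Sum>i. \<integral>\<^sup>+t\<in>dyadic_annulus (k - int i). h t \<partial>lebesgue)"
    by (rule nn_integral_suminf) measurable
  finally show ?thesis .
qed

lemma var_Lebesgue_of_bounded:
  fixes g :: "real ^ 'n \<Rightarrow> 'b::real_normed_vector"
  assumes g: "g \<in> borel_measurable lebesgue" and \<Omega>: "\<Omega> \<in> sets lebesgue" "emeasure lebesgue \<Omega> < \<infinity>"
    and B: "\<And>x. x \<in> \<Omega> \<Longrightarrow> norm (g x) \<le> B" and r: "AE x in lebesgue. 0 \<le> r x"
  shows "g \<in> var_Lebesgue \<Omega> r"
proof -
  define \<eta> where "\<eta> = max B 1"
  have \<eta>: "0 < \<eta>" by (simp add: \<eta>_def)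
  have "var_modular \<Omega> r \<eta> g \<le> (\<integral>\<^sup>+x. indicator \<Omega> x \<partial>lebesgue)"
    unfolding var_modular_def
  proof (rule nn_integral_mono_AE)
    show "AE x in lebesgue. ennreal ((norm (g x) / \<eta>) powr r x) * indicator \<Omega> x \<le> indicator \<Omega> x"
      using r
    proof eventually_elim
      case (elim x)
      have "(norm (g x) / \<eta>) powr r x \<le> 1" if "x \<in> \<Omega>"
        using B[OF that] elim \<eta> by (intro powr_le1) (auto simp: \<eta>_def)
      then show ?case by (auto split: split_indicator)
    qed
  qed
  also have "\<dots> < \<infinity>" using \<Omega> by simp
  finally show ?thesis
    using \<eta> g by (auto simp: var_Lebesgue_def intro!: measurable_restrict_space1)
qed

lemma borel_measurable_of_punctured:
  fixes f :: "real ^ 'n \<Rightarrow> 'b::{banach, second_countable_topology}"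
  assumes "f \<in> borel_measurable (lebesgue_on (- {0}))"
  shows "f \<in> borel_measurable lebesgue"
proof -
  have [measurable]: "(\<lambda>x. indicator (- {0}) x *\<^sub>R f x) \<in> borel_measurable lebesgue"
    using assms by (subst (asm) borel_measurable_restrict_space_iff) auto
  have "(\<lambda>x. if x \<in> {0} then f 0 else indicator (- {0}) x *\<^sub>R f x) \<in> borel_measurable lebesgue"
    by (intro measurable_If_set) auto
  also have "(\<lambda>x. if x \<in> {0} then f 0 else indicator (- {0}) x *\<^sub>R f x) = f" by auto
  finally show ?thesis .
qed

section \<open>The Hardy operator on annuli\<close>

lemma norm_weighted_frac_Hardy_le:
  fixes f :: "real ^ 'n \<Rightarrow> 'b::{banach, second_countable_topology}"
  assumes [measurable]: "f \<in> borel_measurable lebesgue"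
    and w: "0 \<le> w" "w \<le> 1" and x: "x \<noteq> 0" "norm x \<le> 2 powr of_int k"
  shows "ennreal (norm (w *\<^sub>R frac_Hardy \<beta> f x)) \<le> ennreal (norm x powr (\<beta> x - real CARD('n)))
     * (\<Sum>i. \<integral>\<^sup>+t\<in>dyadic_annulus (k - int i). ennreal (norm (f t)) \<partial>lebesgue)"
proof -
  let ?I = "LINT t:{t. norm t < norm x}|lebesgue. f t"
  have "ennreal (norm ?I) \<le> (\<integral>\<^sup>+t\<in>{t. norm t < norm x}. ennreal (norm (f t)) \<partial>lebesgue)"
    by (rule norm_set_integral_le_nn_integral)
  also have "\<dots> \<le> (\<integral>\<^sup>+t\<in>cball 0 (2 powr of_int k). ennreal (norm (f t)) \<partial>lebesgue)"
    using x by (intro nn_integral_mono) (auto split: split_indicator)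
  also have "\<dots> \<le> (\<Sum>i. \<integral>\<^sup>+t\<in>dyadic_annulus (k - int i). ennreal (norm (f t)) \<partial>lebesgue)"
    by (rule nn_integral_cball_le_suminf_annuli) measurable
  finally have I: "ennreal (norm ?I) \<le> \<dots>" .
  have "1 / norm x powr (real CARD('n) - \<beta> x) = norm x powr (\<beta> x - real CARD('n))"
    using powr_minus_divide[of "norm x" "real CARD('n) - \<beta> x"] by simp
  then have "norm (w *\<^sub>R frac_Hardy \<beta> f x) = w * (norm x powr (\<beta> x - real CARD('n)) * norm ?I)"
    using w by (simp add: frac_Hardy_def)
  also have "\<dots> \<le> 1 * (norm x powr (\<beta> x - real CARD('n)) * norm ?I)"
    using w by (intro mult_right_mono) auto
  finally have "ennreal (norm (w *\<^sub>R frac_Hardy \<beta> f x)) \<le> ennreal (norm x powr (\<beta> x - real CARD('n))) * ennreal (norm ?I)"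
    by (simp add: ennreal_leI flip: ennreal_mult)
  then show ?thesis using I by (meson mult_left_mono order_trans zero_le)
qed

text \<open>
  Away from the origin the kernel is bounded, and the integral over a ball is finite; thus the
  image is bounded on compact sets avoiding the origin.
\<close>

lemma frac_Hardy_in_var_Lebesgue_loc:
  fixes f :: "real ^ 'n \<Rightarrow> 'b::{banach, second_countable_topology}"
  assumes f [measurable]: "f \<in> borel_measurable lebesgue"
    and fin: "\<And>k. (\<Sum>i. \<integral>\<^sup>+t\<in>dyadic_annulus (k - int i). ennreal (norm (f t)) \<partial>lebesgue) < \<infinity>" (is "\<And>k. ?S k < _")
    and w [measurable]: "w \<in> borel_measurable lebesgue" and w01: "\<And>x. 0 \<le> w x" "\<And>x. w x \<le> 1"
    and \<beta> [measurable]: "\<beta> \<in> borel_measurable lebesgue" and \<beta>n: "\<And>x. 0 \<le> \<beta> x" "\<And>x. \<beta> x \<le> real CARD('n)"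
    and r: "AE x in lebesgue. 0 \<le> r x"
  shows "(\<lambda>x. w x *\<^sub>R frac_Hardy \<beta> f x) \<in> var_Lebesgue_loc (- {0}) r" (is "?g \<in> _")
proof -
  have radius: "\<exists>k::int. R \<le> 2 powr of_int k" for R :: real
  proof -
    obtain m where "R < 2 ^ m" using real_arch_pow[of 2 R] by auto
    then show ?thesis by (intro exI[of _ "int m"]) (simp add: powr_realpow)
  qed
  have [measurable]: "(\<lambda>x :: real ^ 'n. LINT t:{t. norm t < norm x}|lebesgue. f t) \<in> borel_measurable lebesgue"
  proof (rule borel_measurable_integral_ball[OF f])
    fix R :: real
    obtain k :: int where k: "R \<le> 2 powr of_int k" using radius by blast
    have "(\<integral>\<^sup>+t\<in>cball 0 R. ennreal (norm (f t)) \<partial>lebesgue) \<le> (\<integral>\<^sup>+t\<in>cball 0 (2 powr of_int k). ennreal (norm (f t)) \<partial>lebesgue)"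
      using k by (intro nn_integral_mono) (auto split: split_indicator)
    also have "\<dots> \<le> ?S k"
      by (rule nn_integral_cball_le_suminf_annuli) measurable
    finally show "(\<integral>\<^sup>+t\<in>cball 0 R. ennreal (norm (f t)) \<partial>lebesgue) < \<infinity>"
      using fin[of k] by (rule le_less_trans)
  qed
  have [measurable]: "(\<lambda>x :: real ^ 'n. norm x) \<in> borel_measurable lebesgue"
    by (intro measurable_completion) simp
  have g: "?g \<in> borel_measurable lebesgue"
    unfolding frac_Hardy_def by measurable
  have "?g \<in> var_Lebesgue \<Omega> r" if \<Omega>: "compact \<Omega>" "\<Omega> \<subseteq> - {0}" for \<Omega>
  proof -
    have "open (- \<Omega>)" "0 \<in> - \<Omega>" using \<Omega> compact_imp_closed by auto
    then obtain a where a: "0 < a" "ball 0 a \<subseteq> - \<Omega>" by (auto simp: open_contains_ball)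
    obtain b where b: "\<And>x. x \<in> \<Omega> \<Longrightarrow> norm x \<le> b"
      using compact_imp_bounded[OF \<Omega>(1)] by (auto simp: bounded_iff)
    obtain k :: int where k: "b \<le> 2 powr of_int k" using radius by blast
    define m where "m = min a 1"
    have m: "0 < m" "m \<le> 1" using a by (auto simp: m_def)
    obtain J where J: "?S k = ennreal J" "0 \<le> J" using fin[of k] by (cases "?S k") auto
    show ?thesis
    proof (rule var_Lebesgue_of_bounded[OF g])
      show "\<Omega> \<in> sets lebesgue" "emeasure lebesgue \<Omega> < \<infinity>"
        using lmeasurable_compact[OF \<Omega>(1)] by (auto simp: fmeasurable_def)
      fix x assume x: "x \<in> \<Omega>"
      then have nx: "m \<le> norm x" "x \<noteq> 0" "norm x \<le> 2 powr of_int k"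
        using a b[OF x] k \<Omega> by (force simp: m_def min_le_iff_disj)+
      have "norm x powr (\<beta> x - real CARD('n)) \<le> m powr (\<beta> x - real CARD('n))"
        using nx m \<beta>n[of x] by (intro powr_mono2') auto
      also have "\<dots> \<le> m powr (- real CARD('n))"
        using m \<beta>n(1)[of x] by (intro powr_mono') auto
      finally have "ennreal (norm x powr (\<beta> x - real CARD('n))) * ?S k \<le> ennreal (m powr (- real CARD('n))) * ?S k"
        by (intro mult_right_mono ennreal_leI) auto
      with norm_weighted_frac_Hardy_le[OF f w01 nx(2,3)]
      have "ennreal (norm (?g x)) \<le> ennreal (m powr (- real CARD('n)) * J)"
        using J by (simp add: ennreal_mult) (meson order_trans)
      then show "norm (?g x) \<le> m powr (- real CARD('n)) * J"
        using J by (subst (asm) ennreal_le_iff) auto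
    qed (rule r)
  qed
  then show ?thesis using g by (auto simp: var_Lebesgue_loc_def intro!: measurable_restrict_space1)
qed

text \<open>
  The product of the two one-annulus estimates. The powers \<open>2\<^bsup>jn(1 - 1/s j)\<^esup>\<close> for \<open>j = k - i\<close> and
  \<open>2\<^bsup>- kn(1 - 1/s k)\<^esup>\<close> combine to the convolution kernel \<open>2\<^bsup>- i n \<delta>\<^esup>\<close>. The first conclusion is kept
  separately, as it is what shows that \<open>f\<close> is integrable near the origin.
\<close>

lemma frac_Hardy_annulus_estimates:
  fixes q r \<beta> :: "real ^ 'n \<Rightarrow> real" and \<delta> :: real
  assumes logH: "q \<in> log_hoelder_class" and q_meas: "q \<in> borel_measurable lebesgue"
    and c: "1 < at_infty q" "\<And>x. at_infty q \<le> q x"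
    and \<delta>: "\<delta> \<le> 1 - 1 / at_infty q"
    and \<beta>: "\<And>x. 0 \<le> \<beta> x" "\<And>x. \<beta> x \<le> real CARD('n)"
    and r: "\<And>x. 1 / r x = 1 / q x - \<beta> x / real CARD('n)"
    and rR: "AE x in lebesgue. 1 \<le> r x \<and> r x \<le> R"
  shows "\<exists>K>0. \<forall>f :: real ^ 'n \<Rightarrow> 'b::{banach, second_countable_topology}. \<forall>w. \<forall>k.
      f \<in> borel_measurable lebesgue \<longrightarrow> (\<forall>x. 0 \<le> w x \<and> w x \<le> 1) \<longrightarrow>
      (\<Sum>i. \<integral>\<^sup>+t\<in>dyadic_annulus (k - int i). ennreal (norm (f t)) \<partial>lebesgue)
        \<le> ennreal K * pow2 (of_int k * real CARD('n) * (1 - 1 / (if k \<le> 0 then q 0 else at_infty q))) *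
          (\<Sum>i. pow2 (- (real i * (real CARD('n) * \<delta>))) *
            var_norm UNIV q (\<lambda>x. indicator (dyadic_annulus (k - int i)) x *\<^sub>R f x)) \<and>
      var_norm UNIV r (\<lambda>x. indicator (dyadic_annulus k) x *\<^sub>R (w x *\<^sub>R frac_Hardy \<beta> f x))
        \<le> ennreal K * (\<Sum>i. pow2 (- (real i * (real CARD('n) * \<delta>))) *
            var_norm UNIV q (\<lambda>x. indicator (dyadic_annulus (k - int i)) x *\<^sub>R f x))"
proof -
  let ?n = "real CARD('n)"
  define s where "s k = (if k \<le> 0 then q 0 else at_infty q)" for k :: int
  have s1: "1 \<le> s k" for k using c order_trans[OF less_imp_le[OF c(1)] c(2)] by (auto simp: s_def)
  have q1: "1 \<le> q x" for x using c order_trans[OF less_imp_le[OF c(1)] c(2)] by auto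
  obtain D where D: "0 \<le> D" "\<And>k x. x \<in> dyadic_annulus k \<Longrightarrow> \<bar>of_int k\<bar> * \<bar>q x - s k\<bar> \<le> D"
    using log_hoelder_annulus_bound[OF logH] unfolding s_def by blast
  define K1 where "K1 = unit_ball_vol ?n + 2 powr (?n * D)"
  define K2 where "K2 = 2 powr ?n * (unit_ball_vol ?n * 2 powr (?n * R * D) + 1)"
  have K: "0 < K1" "0 < K2" by (auto simp: K1_def K2_def add_nonneg_pos)
  have s_eq: "1 - 1 / s k = (if k \<le> 0 then 1 - 1 / q 0 else 1 - 1 / at_infty q)" for k
    by (simp add: s_def)
  have v_le_u: "1 - 1 / at_infty q \<le> 1 - 1 / q 0"
    using c(1) c(2)[of 0] by (simp add: frac_le)
  have scale: "a * n * X \<le> b * n * Y + - (i * (n * d))" if "n * (a * X - b * Y) \<le> n * - (i * d)"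
    for a b n X Y i d :: real
    using that by (simp add: algebra_simps)
  have expo: "of_int (k - int i) * ?n * (1 - 1 / s (k - int i)) \<le> of_int k * ?n * (1 - 1 / s k) + - (real i * (?n * \<delta>))" for k i
    using mult_left_mono[OF annulus_exponent_diff_le[OF \<delta> v_le_u, of k i], of ?n]
    unfolding s_eq[symmetric] by (intro scale) simp
  define N where "N f k = var_norm UNIV q (\<lambda>x. indicator (dyadic_annulus k) x *\<^sub>R f x)"
    for f :: "real ^ 'n \<Rightarrow> 'b" and k
  define J where "J f k = (\<Sum>i. pow2 (- (real i * (?n * \<delta>))) * N f (k - int i))"
    for f :: "real ^ 'n \<Rightarrow> 'b" and k
  define S where "S f k = (\<Sum>i. \<integral>\<^sup>+t\<in>dyadic_annulus (k - int i). ennreal (norm (f t)) \<partial>lebesgue)"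
    for f :: "real ^ 'n \<Rightarrow> 'b" and k
  have S_le: "S f k \<le> ennreal K1 * (pow2 (of_int k * ?n * (1 - 1 / s k)) * J f k)"
    if f: "f \<in> borel_measurable lebesgue" for f k
  proof -
    have "(\<integral>\<^sup>+t\<in>dyadic_annulus (k - int i). ennreal (norm (f t)) \<partial>lebesgue)
        \<le> ennreal K1 * (pow2 (of_int k * ?n * (1 - 1 / s k)) * (pow2 (- (real i * (?n * \<delta>))) * N f (k - int i)))" for i
    proof -
      have "(\<integral>\<^sup>+t\<in>dyadic_annulus (k - int i). ennreal (norm (f t)) \<partial>lebesgue)
          \<le> ennreal K1 * pow2 (of_int (k - int i) * ?n * (1 - 1 / s (k - int i))) * N f (k - int i)"
        unfolding K1_def N_def by (intro nn_integral_annulus_le f q_meas q1 s1 D(2))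
      also have "\<dots> \<le> ennreal K1 * pow2 (of_int k * ?n * (1 - 1 / s k) + - (real i * (?n * \<delta>))) * N f (k - int i)"
        by (intro mult_right_mono mult_left_mono ennreal_leI powr_mono expo) auto
      finally show ?thesis by (simp only: mult.assoc pow2_mult[symmetric])
    qed
    then have "S f k \<le> (\<Sum>i. ennreal K1 * (pow2 (of_int k * ?n * (1 - 1 / s k)) * (pow2 (- (real i * (?n * \<delta>))) * N f (k - int i))))"
      unfolding S_def by (intro suminf_le) auto
    then show ?thesis by (simp add: J_def)
  qed
  have H_le: "var_norm UNIV r (\<lambda>x. indicator (dyadic_annulus k) x *\<^sub>R (w x *\<^sub>R frac_Hardy \<beta> f x)) \<le> ennreal (K2 * K1) * J f k"
    if f: "f \<in> borel_measurable lebesgue" and w: "\<And>x. 0 \<le> w x \<and> w x \<le> 1" for f :: "real ^ 'n \<Rightarrow> 'b" and w k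
  proof -
    have "ennreal (norm (w x *\<^sub>R frac_Hardy \<beta> f x)) \<le> ennreal (norm x powr (\<beta> x - ?n)) * S f k"
      if "x \<in> dyadic_annulus k" for x
      unfolding S_def
    proof (rule norm_weighted_frac_Hardy_le[OF f])
      have "2 powr (of_int k - 1) < norm x" "norm x \<le> 2 powr of_int k"
        using that by (auto simp: mem_dyadic_annulus_iff)
      then show "x \<noteq> 0" "norm x \<le> 2 powr of_int k" by auto
    qed (use w in auto)
    then have "var_norm UNIV r (\<lambda>x. indicator (dyadic_annulus k) x *\<^sub>R (w x *\<^sub>R frac_Hardy \<beta> f x))
        \<le> ennreal K2 * pow2 (- of_int k * ?n * (1 - 1 / s k)) * S f k"
      unfolding K2_def by (intro var_norm_annulus_le[OF q1 s1 D \<beta> r rR])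
    also have "\<dots> \<le> ennreal K2 * pow2 (- of_int k * ?n * (1 - 1 / s k)) *
        (ennreal K1 * (pow2 (of_int k * ?n * (1 - 1 / s k)) * J f k))"
      by (intro mult_left_mono S_le f) auto
    also have "\<dots> = ennreal K2 * ennreal K1 *
        (pow2 (- of_int k * ?n * (1 - 1 / s k)) * pow2 (of_int k * ?n * (1 - 1 / s k))) * J f k"
      by (simp only: mult_ac)
    also have "\<dots> = ennreal (K2 * K1) * J f k"
      unfolding pow2_mult using K by (simp add: ennreal_mult)
    finally show ?thesis .
  qed
  let ?K = "max K1 (K2 * K1)"
  have K_le: "ennreal K1 * X \<le> ennreal ?K * X" "ennreal (K2 * K1) * X \<le> ennreal ?K * X" for X
    by (intro mult_right_mono ennreal_leI; simp)+
  show ?thesis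
    unfolding s_def[symmetric] N_def[symmetric] J_def[symmetric] S_def[symmetric]
  proof (intro exI[of _ ?K] conjI allI impI)
    show "0 < ?K" using K by (simp add: less_max_iff_disj)
    fix f :: "real ^ 'n \<Rightarrow> 'b" and w :: "real ^ 'n \<Rightarrow> real" and k
    assume f: "f \<in> borel_measurable lebesgue" and w: "\<forall>x. 0 \<le> w x \<and> w x \<le> 1"
    show "S f k \<le> ennreal ?K * pow2 (of_int k * ?n * (1 - 1 / s k)) * J f k"
      using order_trans[OF S_le[OF f] K_le(1)] by (simp add: mult.assoc)
    show "var_norm UNIV r (\<lambda>x. indicator (dyadic_annulus k) x *\<^sub>R (w x *\<^sub>R frac_Hardy \<beta> f x)) \<le> ennreal ?K * J f k"
      using order_trans[OF H_le[OF f] K_le(2)] w by blast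
  qed
qed
section \<open>Boundedness of the weighted Hardy operator\<close>

theorem theorem3p1:
  fixes q\<^sub>1 q\<^sub>2 \<beta> \<gamma> :: "real ^ 'n \<Rightarrow> real"
    and Cinf C\<^sub>0 \<delta>\<^sub>1 p\<^sub>1 p\<^sub>2 \<alpha> lam :: real
  assumes "q\<^sub>1 \<in> log_hoelder_class \<inter> exponent_class"
    and "1 < at_infty q\<^sub>1"
    and "\<And>x. at_infty q\<^sub>1 \<le> q\<^sub>1 x \<and> ereal (q\<^sub>1 x) \<le> ess_sup q\<^sub>1"
    and "ess_sup q\<^sub>1 < \<infinity>"
    and "\<beta> \<in> borel_measurable lebesgue"
    and "\<And>x. 0 \<le> \<beta> x \<and> \<beta> x < real CARD('n)"
    and "ess_inf \<beta> > 0"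
    and "ess_sup (\<lambda>x. q\<^sub>1 x * \<beta> x) < ereal (real CARD('n))"
    and "ess_sup (\<lambda>x. at_infty q\<^sub>1 * \<beta> x) < ereal (real CARD('n))"
    and "\<And>x. 1 / q\<^sub>2 x = 1 / q\<^sub>1 x - \<beta> x / real CARD('n)"
    and "Cinf > 0"
    and "\<And>x. \<bar>q\<^sub>1 x - at_infty q\<^sub>1\<bar> \<le> Cinf / ln (exp 1 + norm x)"
    and "\<And>x. \<gamma> x = Cinf * \<beta> x * (1 - \<beta> x / real CARD('n))"
    and "0 < \<delta>\<^sub>1" and "ereal \<delta>\<^sub>1 < 1 / ess_sup (conj_exponent q\<^sub>1)"
    and "C\<^sub>0 > 0"
    and "\<And>c r S. r > 0 \<Longrightarrow> S \<in> sets lebesgue \<Longrightarrow> S \<subseteq> ball c r \<Longrightarrow>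
           var_norm UNIV (conj_exponent q\<^sub>1) (indicator S :: real ^ 'n \<Rightarrow> real)
             / var_norm UNIV (conj_exponent q\<^sub>1) (indicator (ball c r) :: real ^ 'n \<Rightarrow> real)
           \<le> ennreal (C\<^sub>0 * (measure lebesgue S / measure lebesgue (ball c r)) powr \<delta>\<^sub>1)"
    and "0 < p\<^sub>1" and "p\<^sub>1 \<le> p\<^sub>2"
    and "lam \<ge> 0"
    and "\<alpha> < lam + real CARD('n) * \<delta>\<^sub>1"
  shows "\<exists>C>0. \<forall>f::real ^ 'n \<Rightarrow> complex. f \<in> herz_morrey \<alpha> lam p\<^sub>1 q\<^sub>1 \<longrightarrow>
           (\<lambda>x. (1 + norm x) powr (- \<gamma> x) *\<^sub>R frac_Hardy \<beta> f x) \<in> herz_morrey \<alpha> lam p\<^sub>2 q\<^sub>2 \<and>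
           herz_morrey_norm \<alpha> lam p\<^sub>2 q\<^sub>2 (\<lambda>x. (1 + norm x) powr (- \<gamma> x) *\<^sub>R frac_Hardy \<beta> f x)
             \<le> ennreal C * herz_morrey_norm \<alpha> lam p\<^sub>1 q\<^sub>1 f"
proof -
  let ?n = "real CARD('n)"
  have logH: "q\<^sub>1 \<in> log_hoelder_class" and q_meas: "q\<^sub>1 \<in> borel_measurable lebesgue"
    using assms(1) by (auto simp: exponent_class_def)
  have \<beta>: "\<And>x. 0 \<le> \<beta> x" "\<And>x. \<beta> x \<le> ?n" using assms(6) by (auto intro: less_imp_le)
  have q1: "1 \<le> q\<^sub>1 x" for x using assms(2) assms(3)[of x] by linarith
  obtain Q where "ess_sup q\<^sub>1 < ereal Q" using ereal_dense2[OF assms(4)] by auto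
  then have qQ: "q\<^sub>1 x \<le> Q" for x
    using assms(3)[of x] by (metis ereal_less_eq(3) less_imp_le order_trans)
  obtain R where rR: "AE x in lebesgue. 1 \<le> q\<^sub>2 x \<and> q\<^sub>2 x \<le> R"
    using AE_sobolev_exponent_bounds[OF q1 qQ \<beta>(1) assms(10) assms(8)] by blast
  have \<delta>: "\<delta>\<^sub>1 \<le> 1 - 1 / at_infty q\<^sub>1"
    using tendsto_at_infty[OF logH] assms(2,14,15) by (rule le_of_less_inverse_ess_sup_conj_exponent)
  define w where "w x = (1 + norm x) powr (- \<gamma> x)" for x
  have \<gamma>_eq: "\<gamma> = (\<lambda>x. Cinf * \<beta> x * (1 - \<beta> x / ?n))" using assms(13) by blast
  have w01: "0 \<le> w x \<and> w x \<le> 1" for x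
  proof -
    have "0 \<le> \<gamma> x" unfolding assms(13) using \<beta>[of x] assms(11) by (intro mult_nonneg_nonneg) auto
    then have "(1 + norm x) powr (- \<gamma> x) \<le> (1 + norm x) powr 0" by (intro powr_mono) auto
    moreover have "1 + norm x \<noteq> 0" using norm_ge_zero[of x] by linarith
    ultimately show ?thesis by (simp add: w_def)
  qed
  have [measurable]: "(\<lambda>x :: real ^ 'n. norm x) \<in> borel_measurable lebesgue"
    by (intro measurable_completion) simp
  have w_meas: "w \<in> borel_measurable lebesgue"
    using assms(5) unfolding w_def[abs_def] \<gamma>_eq by measurable
  define N where "N f k = var_norm UNIV q\<^sub>1 (\<lambda>x. indicator (dyadic_annulus k) x *\<^sub>R f x)"
    for f :: "real ^ 'n \<Rightarrow> complex" and k
  define J where "J f k = (\<Sum>i. pow2 (- (real i * (?n * \<delta>\<^sub>1))) * N f (k - int i))"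
    for f :: "real ^ 'n \<Rightarrow> complex" and k
  obtain K where K: "0 < K" and
    est: "\<forall>f :: real ^ 'n \<Rightarrow> complex. \<forall>w. \<forall>k. f \<in> borel_measurable lebesgue \<longrightarrow> (\<forall>x. 0 \<le> w x \<and> w x \<le> 1) \<longrightarrow>
      (\<Sum>i. \<integral>\<^sup>+t\<in>dyadic_annulus (k - int i). ennreal (norm (f t)) \<partial>lebesgue)
        \<le> ennreal K * pow2 (of_int k * ?n * (1 - 1 / (if k \<le> 0 then q\<^sub>1 0 else at_infty q\<^sub>1))) * J f k \<and>
      var_norm UNIV q\<^sub>2 (\<lambda>x. indicator (dyadic_annulus k) x *\<^sub>R (w x *\<^sub>R frac_Hardy \<beta> f x)) \<le> ennreal K * J f k"
    using frac_Hardy_annulus_estimates[where 'b = complex, OF logH q_meas assms(2) conjunct1[OF assms(3)] \<delta> \<beta> assms(10) rR]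
    unfolding J_def N_def by blast
  have p2: "0 < p\<^sub>2" using assms(18,19) by simp
  have "\<exists>A>0. \<forall>N. herz_morrey_seq \<alpha> lam p\<^sub>2 (\<lambda>k. \<Sum>l. pow2 (- (real l * (?n * \<delta>\<^sub>1))) * N (k - int l))
      \<le> ennreal A * herz_morrey_seq \<alpha> lam p\<^sub>1 N"
    using assms(18,19,21) by (rule herz_morrey_seq_convolution_le)
  then obtain A where "0 < A \<and> (\<forall>N. herz_morrey_seq \<alpha> lam p\<^sub>2 (\<lambda>k. \<Sum>l. pow2 (- (real l * (?n * \<delta>\<^sub>1))) * N (k - int l))
      \<le> ennreal A * herz_morrey_seq \<alpha> lam p\<^sub>1 N)" by (rule exE)
  note A = conjunct1[OF this] conjunct2[OF this]
  have J_le: "herz_morrey_seq \<alpha> lam p\<^sub>2 (J f) \<le> ennreal A * herz_morrey_norm \<alpha> lam p\<^sub>1 q\<^sub>1 f" for f :: "real ^ 'n \<Rightarrow> complex"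
    unfolding herz_morrey_norm_eq_seq J_def[abs_def] N_def by (rule A(2)[rule_format])
  show ?thesis
  proof (intro exI[of _ "K * A"] conjI allI impI)
    show "0 < K * A" using K A(1) by simp
    fix f :: "real ^ 'n \<Rightarrow> complex" assume f: "f \<in> herz_morrey \<alpha> lam p\<^sub>1 q\<^sub>1"
    then have f_meas: "f \<in> borel_measurable lebesgue"
      by (auto simp: herz_morrey_def var_Lebesgue_loc_def intro: borel_measurable_of_punctured)
    have f_fin: "herz_morrey_norm \<alpha> lam p\<^sub>1 q\<^sub>1 f < \<infinity>" using f by (simp add: herz_morrey_def)
    have J_fin: "J f k < \<infinity>" for k
    proof (rule finite_term_of_herz_morrey_seq[OF p2])
      show "herz_morrey_seq \<alpha> lam p\<^sub>2 (J f) < \<infinity>"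
        using le_less_trans[OF J_le[of f]] f_fin by (simp add: ennreal_mult_less_top)
    qed
    let ?g = "\<lambda>x. (1 + norm x) powr (- \<gamma> x) *\<^sub>R frac_Hardy \<beta> f x"
    have "herz_morrey_norm \<alpha> lam p\<^sub>2 q\<^sub>2 ?g \<le> herz_morrey_seq \<alpha> lam p\<^sub>2 (\<lambda>k. ennreal K * J f k)"
      unfolding herz_morrey_norm_eq_seq
    proof (rule herz_morrey_seq_mono[OF _ p2])
      show "var_norm UNIV q\<^sub>2 (\<lambda>x. indicator (dyadic_annulus k) x *\<^sub>R ?g x) \<le> ennreal K * J f k" for k
        using est[rule_format, of f w, OF f_meas w01, of k] unfolding w_def by blast
    qed
    also have "\<dots> = ennreal K * herz_morrey_seq \<alpha> lam p\<^sub>2 (J f)"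
      by (rule herz_morrey_seq_cmult[OF p2])
    also have "\<dots> \<le> ennreal K * (ennreal A * herz_morrey_norm \<alpha> lam p\<^sub>1 q\<^sub>1 f)"
      by (intro mult_left_mono J_le) auto
    also have "\<dots> = ennreal (K * A) * herz_morrey_norm \<alpha> lam p\<^sub>1 q\<^sub>1 f"
      using K A(1) by (simp add: ennreal_mult mult.assoc)
    finally show bound: "herz_morrey_norm \<alpha> lam p\<^sub>2 q\<^sub>2 ?g \<le> \<dots>" .
    have "?g \<in> var_Lebesgue_loc (- {0}) q\<^sub>2"
      unfolding w_def[symmetric]
    proof (rule frac_Hardy_in_var_Lebesgue_loc[OF f_meas _ w_meas _ _ assms(5) \<beta>])
      fix k :: int
      let ?S = "\<Sum>i. \<integral>\<^sup>+t\<in>dyadic_annulus (k - int i). ennreal (norm (f t)) \<partial>lebesgue"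
      have "?S \<le> ennreal K * pow2 (of_int k * ?n * (1 - 1 / (if k \<le> 0 then q\<^sub>1 0 else at_infty q\<^sub>1))) * J f k"
        using est[rule_format, of f w, OF f_meas w01, of k] by blast
      also have "\<dots> < \<infinity>" using J_fin[of k] by (simp add: ennreal_mult_less_top)
      finally show "?S < \<infinity>" .
    qed (use w01 rR in \<open>auto elim!: eventually_mono\<close>)
    moreover have "herz_morrey_norm \<alpha> lam p\<^sub>2 q\<^sub>2 ?g < \<infinity>"
      using le_less_trans[OF bound] f_fin by (simp add: ennreal_mult_less_top)
    ultimately show "?g \<in> herz_morrey \<alpha> lam p\<^sub>2 q\<^sub>2" by (simp add: herz_morrey_def)
  qed
qed

end
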